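(* Let $e\ge 4$, $q\ge 1$, $d\ge 1$ be integers, put $m=e+2q+1$ and assume $\gcd(m,d)=1$. Let $\Gamma=\Gamma_{(e,q,d)}(\mathcal S)$ be the numerical semigroup generated by $\mathcal S=\{m,\;m+d\}\cup\{(q+1)m+(q+i)d\mid 2\le i\le e-1\}$. Then the tangent cone $G_{\mathfrak m}(\Gamma)$ is not Cohen-Macaulay.
   Context: Fix a field $K$. For a numerical semigroup $\Gamma$ generated by $a_1<\dots<a_e$, let $R=K[[t^{a_1},\dots,t^{a_e}]]\subset K[[t]]$ with maximal ideal $\mathfrak m=(t^{a_1},\dots,t^{a_e})$. The tangent cone of $\Gamma$ is the associated graded ring $G_{\mathfrak m}(\Gamma)=\bigoplus_{n\ge 0}\mathfrak m^n/\mathfrak m^{n+1}$. *)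

theory Defs
  imports
    "HOL-Algebra.Ring_Divisibility"
    "HOL-Algebra.Ideal_Product"
    "HOL-Algebra.UnivPoly"
    "HOL-Computational_Algebra.Formal_Power_Series"
    "HOL-Library.Extended_Nat"
begin

section \<open>Commutative algebra\<close>

subsection \<open>Localization\<close>

text \<open>The fraction \<open>a / s\<close> is the class of all pairs \<open>(b, u)\<close> with
  \<open>v (u a - s b) = 0\<close> for some \<open>v \<in> S\<close>.\<close>

definition fraction :: "('a, 'm) ring_scheme \<Rightarrow> 'a set \<Rightarrow> 'a \<Rightarrow> 'a \<Rightarrow> ('a \<times> 'a) set" where
  "fraction R S a s =
     {(b, u). b \<in> carrier R \<and> u \<in> S \<and>
       (\<exists>v\<in>S. v \<otimes>\<^bsub>R\<^esub> (u \<otimes>\<^bsub>R\<^esub> a) = v \<otimes>\<^bsub>R\<^esub> (s \<otimes>\<^bsub>R\<^esub> b))}"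

text \<open>As for the library's \<^const>\<open>FactRing\<close>, the operations are unions over all
  representatives; all members of such a union are equal.\<close>

definition localization :: "('a, 'm) ring_scheme \<Rightarrow> 'a set \<Rightarrow> ('a \<times> 'a) set ring" where
  "localization R S =
     \<lparr>carrier = {fraction R S a s | a s. a \<in> carrier R \<and> s \<in> S},
      mult = (\<lambda>X Y. \<Union>(a, s)\<in>X. \<Union>(b, u)\<in>Y. fraction R S (a \<otimes>\<^bsub>R\<^esub> b) (s \<otimes>\<^bsub>R\<^esub> u)),
      one = fraction R S \<one>\<^bsub>R\<^esub> \<one>\<^bsub>R\<^esub>,
      zero = fraction R S \<zero>\<^bsub>R\<^esub> \<one>\<^bsub>R\<^esub>,
      add = (\<lambda>X Y. \<Union>(a, s)\<in>X. \<Union>(b, u)\<in>Y.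
               fraction R S ((u \<otimes>\<^bsub>R\<^esub> a) \<oplus>\<^bsub>R\<^esub> (s \<otimes>\<^bsub>R\<^esub> b)) (s \<otimes>\<^bsub>R\<^esub> u))\<rparr>"

locale mult_subset = cring +
  fixes S
  assumes S_sub: "S \<subseteq> carrier R" and S_one: "\<one> \<in> S"
    and S_mult: "s \<in> S \<Longrightarrow> t \<in> S \<Longrightarrow> s \<otimes> t \<in> S"
begin

lemma S_carr [simp]: "s \<in> S \<Longrightarrow> s \<in> carrier R" using S_sub by blast

lemma fraction_eqI:
  assumes "a \<in> carrier R" "b \<in> carrier R" "s \<in> S" "u \<in> S" "v \<in> S"
    and e: "v \<otimes> (u \<otimes> a) = v \<otimes> (s \<otimes> b)"
  shows "fraction R S a s = fraction R S b u"
proof -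
  have *: "fraction R S a s \<subseteq> fraction R S b u"
    if "a \<in> carrier R" "b \<in> carrier R" "s \<in> S" "u \<in> S" "v \<in> S"
      and e: "v \<otimes> (u \<otimes> a) = v \<otimes> (s \<otimes> b)" for a b s u v
  proof (rule subsetI)
    fix p assume "p \<in> fraction R S a s"
    then obtain c w x where p: "p = (c, w)" "c \<in> carrier R" "w \<in> S" "x \<in> S"
      "x \<otimes> (w \<otimes> a) = x \<otimes> (s \<otimes> c)" by (auto simp: fraction_def)
    note carr = that(1,2) that(3-5)[THEN S_carr] p(2) p(3,4)[THEN S_carr]
    have "(x \<otimes> v \<otimes> s) \<otimes> (w \<otimes> b) = (x \<otimes> w) \<otimes> (v \<otimes> (s \<otimes> b))" using carr by algebra
    also have "\<dots> = (x \<otimes> w) \<otimes> (v \<otimes> (u \<otimes> a))" using e by simp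
    also have "\<dots> = (v \<otimes> u) \<otimes> (x \<otimes> (w \<otimes> a))" using carr by algebra
    also have "\<dots> = (v \<otimes> u) \<otimes> (x \<otimes> (s \<otimes> c))" using p by simp
    also have "\<dots> = (x \<otimes> v \<otimes> s) \<otimes> (u \<otimes> c)" using carr by algebra
    finally show "p \<in> fraction R S b u" using p that S_mult by (auto simp: fraction_def)
  qed
  show ?thesis using *[OF assms] *[OF assms(2,1,4,3,5) e[symmetric]] by blast
qed

lemma fraction_self: "a \<in> carrier R \<Longrightarrow> s \<in> S \<Longrightarrow> (a, s) \<in> fraction R S a s"
  using S_one by (auto simp: fraction_def)

lemma fraction_eq_iff:
  assumes "a \<in> carrier R" "b \<in> carrier R" "s \<in> S" "u \<in> S"
  shows "fraction R S a s = fraction R S b u \<longleftrightarrow> (\<exists>v\<in>S. v \<otimes> (u \<otimes> a) = v \<otimes> (s \<otimes> b))"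
proof
  assume "fraction R S a s = fraction R S b u"
  then have "(b, u) \<in> fraction R S a s" using fraction_self assms by blast
  then show "\<exists>v\<in>S. v \<otimes> (u \<otimes> a) = v \<otimes> (s \<otimes> b)" by (auto simp: fraction_def)
qed (use assms fraction_eqI in blast)

lemma fraction_memD:
  assumes "(b, u) \<in> fraction R S a s" "a \<in> carrier R" "s \<in> S"
  shows "b \<in> carrier R" "u \<in> S" "fraction R S b u = fraction R S a s"
    "\<exists>v\<in>S. v \<otimes> (u \<otimes> a) = v \<otimes> (s \<otimes> b)"
proof -
  show 1: "b \<in> carrier R" "u \<in> S" "\<exists>v\<in>S. v \<otimes> (u \<otimes> a) = v \<otimes> (s \<otimes> b)"
    using assms by (auto simp: fraction_def)
  show "fraction R S b u = fraction R S a s"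
    using fraction_eq_iff[of a b s u] 1 assms(2,3) by metis
qed

lemma fraction_mult:
  assumes "a \<in> carrier R" "b \<in> carrier R" "s \<in> S" "u \<in> S"
  shows "fraction R S a s \<otimes>\<^bsub>localization R S\<^esub> fraction R S b u = fraction R S (a \<otimes> b) (s \<otimes> u)"
proof -
  have "fraction R S (a' \<otimes> b') (s' \<otimes> u') = fraction R S (a \<otimes> b) (s \<otimes> u)"
    if m: "(a', s') \<in> fraction R S a s" "(b', u') \<in> fraction R S b u" for a' s' b' u'
  proof -
    obtain v w where vw: "v \<in> S" "v \<otimes> (s' \<otimes> a) = v \<otimes> (s \<otimes> a')"
      "w \<in> S" "w \<otimes> (u' \<otimes> b) = w \<otimes> (u \<otimes> b')"
      using fraction_memD(4)[OF m(1)] fraction_memD(4)[OF m(2)] assms by blast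
    note a' = fraction_memD(1,2)[OF m(1) assms(1,3)] and b' = fraction_memD(1,2)[OF m(2) assms(2,4)]
    note carr = assms(1,2) assms(3,4)[THEN S_carr] a'(1) b'(1)
      a'(2)[THEN S_carr] b'(2)[THEN S_carr] vw(1,3)[THEN S_carr]
    have "(v \<otimes> w) \<otimes> ((s \<otimes> u) \<otimes> (a' \<otimes> b')) = (v \<otimes> (s \<otimes> a')) \<otimes> (w \<otimes> (u \<otimes> b'))"
      using carr by algebra
    also have "\<dots> = (v \<otimes> (s' \<otimes> a)) \<otimes> (w \<otimes> (u' \<otimes> b))" using vw by simp
    also have "\<dots> = (v \<otimes> w) \<otimes> ((s' \<otimes> u') \<otimes> (a \<otimes> b))" using carr by algebra
    finally show ?thesis
      using assms a' b' vw S_mult by (intro fraction_eqI[where v = "v \<otimes> w"]) auto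
  qed
  then have "\<And>X. X \<in> (\<lambda>((a', s'), (b', u')). fraction R S (a' \<otimes> b') (s' \<otimes> u')) ` (fraction R S a s \<times> fraction R S b u)
      \<Longrightarrow> X = fraction R S (a \<otimes> b) (s \<otimes> u)" by auto
  then show ?thesis using fraction_self[OF assms(1,3)] fraction_self[OF assms(2,4)]
    unfolding localization_def by simp fast
qed

lemma fraction_add:
  assumes "a \<in> carrier R" "b \<in> carrier R" "s \<in> S" "u \<in> S"
  shows "fraction R S a s \<oplus>\<^bsub>localization R S\<^esub> fraction R S b u
    = fraction R S ((u \<otimes> a) \<oplus> (s \<otimes> b)) (s \<otimes> u)"
proof -
  have "fraction R S ((u' \<otimes> a') \<oplus> (s' \<otimes> b')) (s' \<otimes> u') = fraction R S ((u \<otimes> a) \<oplus> (s \<otimes> b)) (s \<otimes> u)"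
    if m: "(a', s') \<in> fraction R S a s" "(b', u') \<in> fraction R S b u" for a' s' b' u'
  proof -
    obtain v w where vw: "v \<in> S" "v \<otimes> (s' \<otimes> a) = v \<otimes> (s \<otimes> a')"
      "w \<in> S" "w \<otimes> (u' \<otimes> b) = w \<otimes> (u \<otimes> b')"
      using fraction_memD(4)[OF m(1)] fraction_memD(4)[OF m(2)] assms by blast
    note a' = fraction_memD(1,2)[OF m(1) assms(1,3)] and b' = fraction_memD(1,2)[OF m(2) assms(2,4)]
    note carr = assms(1,2) assms(3,4)[THEN S_carr] a'(1) b'(1)
      a'(2)[THEN S_carr] b'(2)[THEN S_carr] vw(1,3)[THEN S_carr]
    have "(v \<otimes> w) \<otimes> ((s \<otimes> u) \<otimes> ((u' \<otimes> a') \<oplus> (s' \<otimes> b')))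
        = (w \<otimes> u \<otimes> u') \<otimes> (v \<otimes> (s \<otimes> a')) \<oplus> (v \<otimes> s \<otimes> s') \<otimes> (w \<otimes> (u \<otimes> b'))"
      using carr by algebra
    also have "\<dots> = (w \<otimes> u \<otimes> u') \<otimes> (v \<otimes> (s' \<otimes> a)) \<oplus> (v \<otimes> s \<otimes> s') \<otimes> (w \<otimes> (u' \<otimes> b))"
      using vw by simp
    also have "\<dots> = (v \<otimes> w) \<otimes> ((s' \<otimes> u') \<otimes> ((u \<otimes> a) \<oplus> (s \<otimes> b)))" using carr by algebra
    finally show ?thesis
      using assms a' b' vw S_mult by (intro fraction_eqI[where v = "v \<otimes> w"]) auto
  qed
  then have "\<And>X. X \<in> (\<lambda>((a', s'), (b', u')). fraction R S ((u' \<otimes> a') \<oplus> (s' \<otimes> b')) (s' \<otimes> u')) `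
        (fraction R S a s \<times> fraction R S b u)
      \<Longrightarrow> X = fraction R S ((u \<otimes> a) \<oplus> (s \<otimes> b)) (s \<otimes> u)" by auto
  then show ?thesis using fraction_self[OF assms(1,3)] fraction_self[OF assms(2,4)]
    unfolding localization_def by simp fast
qed

lemma fraction_carrier: "a \<in> carrier R \<Longrightarrow> s \<in> S \<Longrightarrow> fraction R S a s \<in> carrier (localization R S)"
  by (auto simp: localization_def)

lemma localization_carrierE:
  assumes "X \<in> carrier (localization R S)"
  obtains a s where "a \<in> carrier R" "s \<in> S" "X = fraction R S a s"
  using assms by (auto simp: localization_def)

lemma localization_one: "\<one>\<^bsub>localization R S\<^esub> = fraction R S \<one> \<one>"
  and localization_zero: "\<zero>\<^bsub>localization R S\<^esub> = fraction R S \<zero> \<one>"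
  by (simp_all add: localization_def)

lemma fraction_eqI1:
  assumes "a \<in> carrier R" "b \<in> carrier R" "s \<in> S" "u \<in> S" "u \<otimes> a = s \<otimes> b"
  shows "fraction R S a s = fraction R S b u"
  using assms S_one by (intro fraction_eqI[where v = \<one>]) auto

lemmas fraction_simps = fraction_mult fraction_add fraction_carrier localization_one localization_zero S_one S_mult

lemma localization_cring: "cring (localization R S)"
proof (rule cringI)
  let ?L = "localization R S"
  show "abelian_group ?L"
  proof (rule abelian_groupI)
    fix X assume "X \<in> carrier ?L"
    then obtain a s where X: "a \<in> carrier R" "s \<in> S" "X = fraction R S a s"
      by (rule localization_carrierE)
    show "\<zero>\<^bsub>?L\<^esub> \<oplus>\<^bsub>?L\<^esub> X = X" using X by (simp add: fraction_simps)
    have "fraction R S (\<ominus> a) s \<oplus>\<^bsub>?L\<^esub> X = \<zero>\<^bsub>?L\<^esub>"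
      using X by (simp add: fraction_simps r_minus l_neg) (rule fraction_eqI1, auto simp: S_one S_mult)
    then show "\<exists>Y\<in>carrier ?L. Y \<oplus>\<^bsub>?L\<^esub> X = \<zero>\<^bsub>?L\<^esub>" using X fraction_carrier a_inv_closed by blast
    fix Y assume "Y \<in> carrier ?L"
    then obtain b u where Y: "b \<in> carrier R" "u \<in> S" "Y = fraction R S b u"
      by (rule localization_carrierE)
    show "X \<oplus>\<^bsub>?L\<^esub> Y \<in> carrier ?L" using X Y by (simp add: fraction_simps)
    show "X \<oplus>\<^bsub>?L\<^esub> Y = Y \<oplus>\<^bsub>?L\<^esub> X" using X Y by (simp add: fraction_simps a_comm m_comm)
    fix Z assume "Z \<in> carrier ?L"
    then obtain c w where Z: "c \<in> carrier R" "w \<in> S" "Z = fraction R S c w"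
      by (rule localization_carrierE)
    note carr = X(1) Y(1) Z(1) X(2)[THEN S_carr] Y(2)[THEN S_carr] Z(2)[THEN S_carr]
    show "X \<oplus>\<^bsub>?L\<^esub> Y \<oplus>\<^bsub>?L\<^esub> Z = X \<oplus>\<^bsub>?L\<^esub> (Y \<oplus>\<^bsub>?L\<^esub> Z)"
      using X Y Z by (simp add: fraction_simps) (rule fraction_eqI1, simp_all add: S_mult, use carr in algebra)
  qed (simp add: fraction_simps)
  show "comm_monoid ?L"
  proof (rule comm_monoidI)
    fix X assume "X \<in> carrier ?L"
    then obtain a s where X: "a \<in> carrier R" "s \<in> S" "X = fraction R S a s"
      by (rule localization_carrierE)
    show "\<one>\<^bsub>?L\<^esub> \<otimes>\<^bsub>?L\<^esub> X = X" using X by (simp add: fraction_simps)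
    fix Y assume "Y \<in> carrier ?L"
    then obtain b u where Y: "b \<in> carrier R" "u \<in> S" "Y = fraction R S b u"
      by (rule localization_carrierE)
    show "X \<otimes>\<^bsub>?L\<^esub> Y \<in> carrier ?L" using X Y by (simp add: fraction_simps)
    show "X \<otimes>\<^bsub>?L\<^esub> Y = Y \<otimes>\<^bsub>?L\<^esub> X" using X Y by (simp add: fraction_simps m_comm)
    fix Z assume "Z \<in> carrier ?L"
    then obtain c w where Z: "c \<in> carrier R" "w \<in> S" "Z = fraction R S c w"
      by (rule localization_carrierE)
    show "X \<otimes>\<^bsub>?L\<^esub> Y \<otimes>\<^bsub>?L\<^esub> Z = X \<otimes>\<^bsub>?L\<^esub> (Y \<otimes>\<^bsub>?L\<^esub> Z)"
      using X Y Z by (simp add: fraction_simps m_assoc)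
  qed (simp add: fraction_simps)
next
  let ?L = "localization R S"
  fix X Y Z assume "X \<in> carrier ?L" "Y \<in> carrier ?L" "Z \<in> carrier ?L"
  then obtain a s b u c w where X: "a \<in> carrier R" "s \<in> S" "X = fraction R S a s"
    and Y: "b \<in> carrier R" "u \<in> S" "Y = fraction R S b u"
    and Z: "c \<in> carrier R" "w \<in> S" "Z = fraction R S c w"
    by (auto elim!: localization_carrierE)
  note carr = X(1) Y(1) Z(1) X(2)[THEN S_carr] Y(2)[THEN S_carr] Z(2)[THEN S_carr]
  show "(X \<oplus>\<^bsub>?L\<^esub> Y) \<otimes>\<^bsub>?L\<^esub> Z = X \<otimes>\<^bsub>?L\<^esub> Z \<oplus>\<^bsub>?L\<^esub> Y \<otimes>\<^bsub>?L\<^esub> Z"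
    using X Y Z by (simp add: fraction_simps) (rule fraction_eqI1, simp_all add: S_mult, use carr in algebra)
qed

end

subsection \<open>Depth, dimension and the Cohen--Macaulay property\<close>

text \<open>The \<open>i\<close>-th condition says that \<open>x\<^sub>i\<close> is a nonzerodivisor on
  \<open>R / (x\<^sub>0, \<dots>, x\<^sub>i\<^sub>-\<^sub>1)\<close>.\<close>

definition regular_sequence :: "('a, 'm) ring_scheme \<Rightarrow> 'a list \<Rightarrow> bool" where
  "regular_sequence R xs \<longleftrightarrow>
     set xs \<subseteq> carrier R \<and>
     (\<forall>i<length xs. \<forall>a\<in>carrier R.
        xs ! i \<otimes>\<^bsub>R\<^esub> a \<in> genideal R (set (take i xs)) \<longrightarrow> a \<in> genideal R (set (take i xs))) \<and>
     genideal R (set xs) \<noteq> carrier R"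

definition depth :: "('a, 'm) ring_scheme \<Rightarrow> 'a set \<Rightarrow> enat" where
  "depth R I = Sup {enat (length xs) | xs. regular_sequence R xs \<and> set xs \<subseteq> I}"

definition krull_dim :: "('a, 'm) ring_scheme \<Rightarrow> enat" where
  "krull_dim R = Sup {enat n | n. \<exists>P :: nat \<Rightarrow> 'a set.
     (\<forall>i\<le>n. primeideal (P i) R) \<and> (\<forall>i<n. P i \<subset> P (Suc i))}"

text \<open>The maximal ideal of a local ring consists of its nonunits.\<close>

definition cohen_macaulay_local :: "('a, 'm) ring_scheme \<Rightarrow> bool" where
  "cohen_macaulay_local R \<longleftrightarrow> depth R (carrier R - Units R) = krull_dim R"

definition cohen_macaulay :: "('a, 'm) ring_scheme \<Rightarrow> bool" where
  "cohen_macaulay R \<longleftrightarrow>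
     cring R \<and> noetherian_ring R \<and>
     (\<forall>M. maximalideal M R \<longrightarrow> cohen_macaulay_local (localization R (carrier R - M)))"

lemma (in cring) prime_complement_mult_subset:
  assumes "primeideal P R" shows "mult_subset R (carrier R - P)"
proof -
  interpret primeideal P R by fact
  show ?thesis
    by unfold_locales (use I_prime I_notcarr one_imp_carrier in auto)
qed


subsection \<open>The associated graded ring\<close>

abbreviation ideal_pow :: "('a, 'm) ring_scheme \<Rightarrow> 'a set \<Rightarrow> nat \<Rightarrow> 'a set" where
  "ideal_pow R I n \<equiv> I [^]\<^bsub>ideals_set R\<^esub> n"

text \<open>An element of the direct sum of the \<open>I\<^sup>n / I\<^sup>n\<^sup>+\<^sup>1\<close> is the sequence \<open>f\<close> of its
  homogeneous components; \<open>f n\<close> is a coset of \<open>I\<^sup>n\<^sup>+\<^sup>1\<close> contained in \<open>I\<^sup>n\<close>, and almost all of them are zero.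
  The product is \<open>(x + I\<^sup>i\<^sup>+\<^sup>1) (y + I\<^sup>j\<^sup>+\<^sup>1) = x y + I\<^sup>i\<^sup>+\<^sup>j\<^sup>+\<^sup>1\<close> extended
  bilinearly; it is again written as a union over all representatives.\<close>

definition assoc_graded :: "('a, 'm) ring_scheme \<Rightarrow> 'a set \<Rightarrow> (nat \<Rightarrow> 'a set) ring" where
  "assoc_graded R I =
     \<lparr>carrier = {f. (\<forall>n. \<exists>x\<in>ideal_pow R I n. f n = ideal_pow R I (Suc n) +>\<^bsub>R\<^esub> x) \<and>
                    finite {n. f n \<noteq> ideal_pow R I (Suc n)}},
      mult = (\<lambda>f g n. \<Union>x\<in>(\<Pi> i\<in>{..n}. f i). \<Union>y\<in>(\<Pi> j\<in>{..n}. g j).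
                ideal_pow R I (Suc n) +>\<^bsub>R\<^esub> (\<Oplus>\<^bsub>R\<^esub>i\<in>{..n}. x i \<otimes>\<^bsub>R\<^esub> y (n - i))),
      one = (\<lambda>n. if n = 0 then ideal_pow R I 1 +>\<^bsub>R\<^esub> \<one>\<^bsub>R\<^esub> else ideal_pow R I (Suc n)),
      zero = (\<lambda>n. ideal_pow R I (Suc n)),
      add = (\<lambda>f g n. f n <+>\<^bsub>R\<^esub> g n)\<rparr>"

locale graded = cring +
  fixes I
  assumes I_ideal: "ideal I R"
begin

context
  notes nat_pow_Suc [simp del] Group.nat_pow_Suc [simp del]
    and nat_pow_0 [simp del] Group.nat_pow_0 [simp del]
begin

abbreviation "IP n \<equiv> ideal_pow R I n"

lemma IP_ideal: "ideal (IP n) R"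
proof -
  interpret M: comm_monoid "ideals_set R" by (rule ideals_set_is_comm_monoid)
  have "I \<in> carrier (ideals_set R)" using I_ideal by (simp add: ideals_set_def)
  then have "IP n \<in> carrier (ideals_set R)" by (rule M.nat_pow_closed)
  then show ?thesis by (simp add: ideals_set_def)
qed

lemma IP_0 [simp]: "IP 0 = carrier R"
  by (simp add: ideals_set_def nat_pow_def)

lemma IP_Suc: "IP (Suc n) = ideal_prod R (IP n) I"
  by (simp add: ideals_set_def nat_pow_def)

lemma IP_1 [simp]: "IP (Suc 0) = I"
proof -
  interpret M: comm_monoid "ideals_set R" by (rule ideals_set_is_comm_monoid)
  show ?thesis using I_ideal M.nat_pow_eone[of I] by (simp add: ideals_set_def)
qed

lemma IP_carr: "x \<in> IP n \<Longrightarrow> x \<in> carrier R"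
  using IP_ideal ideal.Icarr by metis

lemma IP_Suc_subset: "IP (Suc n) \<subseteq> IP n"
  unfolding IP_Suc using ideal_prod_inter[OF IP_ideal I_ideal] by blast

lemma IP_mult: "x \<in> IP i \<Longrightarrow> y \<in> IP j \<Longrightarrow> x \<otimes> y \<in> IP (i + j)"
proof -
  assume "x \<in> IP i" "y \<in> IP j"
  interpret M: comm_monoid "ideals_set R" by (rule ideals_set_is_comm_monoid)
  have "I \<in> carrier (ideals_set R)" using I_ideal by (simp add: ideals_set_def)
  then have "IP i \<otimes>\<^bsub>ideals_set R\<^esub> IP j = IP (i + j)" by (rule M.nat_pow_mult)
  then have "ideal_prod R (IP i) (IP j) = IP (i + j)" by (simp add: ideals_set_def)
  then show ?thesis using ideal_prod.prod[OF \<open>x \<in> IP i\<close> \<open>y \<in> IP j\<close>, of R] by simp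
qed

lemma finsum_IP:
  assumes "finite B" "\<And>i. i \<in> B \<Longrightarrow> f i \<in> IP n"
  shows "finsum R f B \<in> IP n"
  using assms
proof (induction B)
  case empty
  then show ?case using additive_subgroup.zero_closed[OF ideal.axioms(1)[OF IP_ideal]] by simp
next
  case (insert b B)
  then have "finsum R f (insert b B) = f b \<oplus> finsum R f B"
    by (intro finsum_insert) (auto intro: IP_carr)
  then show ?case
    using insert additive_subgroup.a_closed[OF ideal.axioms(1)[OF IP_ideal]] by auto
qed

lemma add_diff_cancel: "h \<in> carrier R \<Longrightarrow> z \<in> carrier R \<Longrightarrow> (h \<oplus> z) \<ominus> z = h"
  by (simp add: a_minus_def a_assoc r_neg)

lemma diff_add_cancel: "a \<in> carrier R \<Longrightarrow> b \<in> carrier R \<Longrightarrow> (a \<ominus> b) \<oplus> b = a"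
  by (simp add: a_minus_def a_assoc l_neg)

definition cls :: "(nat \<Rightarrow> 'a) \<Rightarrow> nat \<Rightarrow> 'a set" where
  "cls x n = IP (Suc n) +> x n"

definition reps :: "(nat \<Rightarrow> 'a) set" where
  "reps = {x \<in> up R. \<forall>n. x n \<in> IP n}"

lemma repsD: "x \<in> reps \<Longrightarrow> x n \<in> IP n" "x \<in> reps \<Longrightarrow> x \<in> up R"
  "x \<in> reps \<Longrightarrow> x n \<in> carrier R"
  by (auto simp: reps_def)

lemma coset_eq_iff:
  assumes "x \<in> carrier R" "y \<in> carrier R"
  shows "IP n +> x = IP n +> y \<longleftrightarrow> x \<ominus> y \<in> IP n"
  by (rule quotient_eq_iff_same_a_r_cos[OF IP_ideal assms, symmetric])

lemma carrier_assoc_graded: "carrier (assoc_graded R I) = cls ` reps"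
proof (intro equalityI subsetI)
  fix f assume "f \<in> carrier (assoc_graded R I)"
  then have ex: "\<forall>n. \<exists>x\<in>IP n. f n = IP (Suc n) +> x" and fin: "finite {n. f n \<noteq> IP (Suc n)}"
    by (simp_all add: assoc_graded_def)
  then obtain x0 where x0: "\<And>n. x0 n \<in> IP n" "\<And>n. f n = IP (Suc n) +> x0 n" by metis
  define x where "x n = (if f n = IP (Suc n) then \<zero> else x0 n)" for n
  have xI: "x n \<in> IP n" for n
    using x0(1) additive_subgroup.zero_closed[OF ideal.axioms(1)[OF IP_ideal]] by (simp add: x_def)
  obtain N where "\<And>n. f n \<noteq> IP (Suc n) \<Longrightarrow> n \<le> N"
    using finite_nat_set_iff_bounded_le[of "{n. f n \<noteq> IP (Suc n)}"] fin by auto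
  then have "bound \<zero> N x" 
  proof (intro bound.intro)
    show "x k = \<zero>" if "N < k" for k using \<open>\<And>n. f n \<noteq> IP (Suc n) \<Longrightarrow> n \<le> N\<close>[of k] that
      by (cases "f k = IP (Suc k)") (simp_all add: x_def)
  qed
  then have "x \<in> reps" using xI IP_carr by (auto simp: reps_def intro!: mem_upI)
  moreover have "f = cls x"
  proof
    fix n
    interpret J: ideal "IP (Suc n)" R by (rule IP_ideal)
    show "f n = cls x n"
      using x0(2)[of n] a_coset_add_zero[OF J.a_subset] by (auto simp: cls_def x_def)
  qed
  ultimately show "f \<in> cls ` reps" by blast
next
  fix f assume "f \<in> cls ` reps"
  then obtain x where x: "x \<in> reps" "f = cls x" by blast
  then obtain N where N: "bound \<zero> N x" using repsD by blast
  have "f n = IP (Suc n)" if "n > N" for n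
  proof -
    interpret J: ideal "IP (Suc n)" R by (rule IP_ideal)
    have "x n = \<zero>" using N that by auto
    then show ?thesis using a_coset_add_zero[OF J.a_subset] x by (simp add: cls_def)
  qed
  then have "{n. f n \<noteq> IP (Suc n)} \<subseteq> {..N}" by (fastforce simp: not_less)
  then have "finite {n. f n \<noteq> IP (Suc n)}" using finite_subset by blast
  then show "f \<in> carrier (assoc_graded R I)"
    using x repsD by (auto simp: assoc_graded_def cls_def)
qed

lemma cls_add:
  assumes "x \<in> reps" "y \<in> reps"
  shows "cls x \<oplus>\<^bsub>assoc_graded R I\<^esub> cls y = cls (x \<oplus>\<^bsub>UP R\<^esub> y)"
    and "x \<oplus>\<^bsub>UP R\<^esub> y \<in> reps"
proof -
  have *: "x \<oplus>\<^bsub>UP R\<^esub> y = (\<lambda>i. x i \<oplus> y i)" using repsD assms by (simp add: UP_def)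
  show "cls x \<oplus>\<^bsub>assoc_graded R I\<^esub> cls y = cls (x \<oplus>\<^bsub>UP R\<^esub> y)"
  proof
    fix n
    interpret J: ideal "IP (Suc n)" R by (rule IP_ideal)
    show "(cls x \<oplus>\<^bsub>assoc_graded R I\<^esub> cls y) n = cls (x \<oplus>\<^bsub>UP R\<^esub> y) n"
      using J.a_rcos_sum[of "x n" "y n"] assms repsD
      by (simp add: assoc_graded_def cls_def *)
  qed
  show "x \<oplus>\<^bsub>UP R\<^esub> y \<in> reps" unfolding reps_def
  proof (intro CollectI conjI allI)
    show "x \<oplus>\<^bsub>UP R\<^esub> y \<in> up R" unfolding * using up_add_closed assms repsD by blast
    fix n show "(x \<oplus>\<^bsub>UP R\<^esub> y) n \<in> IP n"
      using additive_subgroup.a_closed[OF ideal.axioms(1)[OF IP_ideal]] repsD assms by (simp add: *)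
  qed
qed

lemma UN2_const:
  "a \<in> P \<Longrightarrow> b \<in> Q \<Longrightarrow> (\<And>u v. u \<in> P \<Longrightarrow> v \<in> Q \<Longrightarrow> F u v = C)
    \<Longrightarrow> (\<Union>x\<in>P. \<Union>y\<in>Q. F x y) = C"
  by blast

lemma cls_mult:
  assumes "x \<in> reps" "y \<in> reps"
  shows "cls x \<otimes>\<^bsub>assoc_graded R I\<^esub> cls y = cls (x \<otimes>\<^bsub>UP R\<^esub> y)"
    and "x \<otimes>\<^bsub>UP R\<^esub> y \<in> reps"
proof -
  have *: "x \<otimes>\<^bsub>UP R\<^esub> y = (\<lambda>n. \<Oplus>i\<in>{..n}. x i \<otimes> y (n - i))" using repsD assms by (simp add: UP_def)
  show "cls x \<otimes>\<^bsub>assoc_graded R I\<^esub> cls y = cls (x \<otimes>\<^bsub>UP R\<^esub> y)"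
  proof
    fix n
    have mem: "u i \<in> IP i \<and> u i \<ominus> z i \<in> IP (Suc i)" if uz: "u i \<in> cls z i" "z \<in> reps" for u z i
    proof -
      interpret J: ideal "IP (Suc i)" R by (rule IP_ideal)
      interpret J': ideal "IP i" R by (rule IP_ideal)
      obtain h where h: "h \<in> IP (Suc i)" "u i = h \<oplus> z i"
        using uz(1) by (auto simp: cls_def a_r_coset_def')
      then have "u i \<ominus> z i = h" using repsD(3)[OF uz(2)] IP_carr by (simp add: add_diff_cancel)
      moreover have "u i \<in> IP i" using h IP_Suc_subset repsD(1)[OF uz(2)] by auto
      ultimately show ?thesis using h by simp
    qed
    have const: "IP (Suc n) +> (\<Oplus>i\<in>{..n}. u i \<otimes> v (n - i)) = cls (x \<otimes>\<^bsub>UP R\<^esub> y) n"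
      if u: "u \<in> (\<Pi> i\<in>{..n}. cls x i)" and v: "v \<in> (\<Pi> i\<in>{..n}. cls y i)" for u v
    proof -
      have mu: "u i \<in> IP i" "u i \<ominus> x i \<in> IP (Suc i)" if "i \<le> n" for i
        using mem[of u i x] u that assms by auto
      have mv: "v i \<in> IP i" "v i \<ominus> y i \<in> IP (Suc i)" if "i \<le> n" for i
        using mem[of v i y] v that assms by auto
      have d: "u i \<otimes> v (n - i) \<ominus> x i \<otimes> y (n - i) \<in> IP (Suc n)" if "i \<le> n" for i
      proof -
        interpret J: ideal "IP (Suc n)" R by (rule IP_ideal)
        have carr: "u i \<in> carrier R" "v (n - i) \<in> carrier R" "x i \<in> carrier R" "y (n - i) \<in> carrier R"
          using mu(1)[OF that] mv(1)[of "n - i"] repsD(3) assms by (auto intro: IP_carr)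
        have "u i \<otimes> v (n - i) \<ominus> x i \<otimes> y (n - i)
            = u i \<otimes> (v (n - i) \<ominus> y (n - i)) \<oplus> (u i \<ominus> x i) \<otimes> y (n - i)"
          using carr by algebra
        moreover have "u i \<otimes> (v (n - i) \<ominus> y (n - i)) \<in> IP (Suc n)"
          using IP_mult[OF mu(1)[OF that] mv(2)[of "n - i"]] that by simp
        moreover have "(u i \<ominus> x i) \<otimes> y (n - i) \<in> IP (Suc n)"
          using IP_mult[OF mu(2)[OF that] repsD(1)[OF assms(2), of "n - i"]] that by simp
        ultimately show ?thesis by simp
      qed
      have c1: "(\<lambda>i. u i \<otimes> v (n - i)) \<in> {..n} \<rightarrow> carrier R"
      proof (intro Pi_I m_closed)
        fix i assume i: "i \<in> {..n}"
        show "u i \<in> carrier R" using IP_carr[OF mu(1)] i by simp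
        show "v (n - i) \<in> carrier R" using IP_carr[OF mv(1)[of "n - i"]] by simp
      qed
      have c2: "(\<lambda>i. x i \<otimes> y (n - i)) \<in> {..n} \<rightarrow> carrier R"
        using repsD assms by auto
      have c3: "(\<lambda>i. u i \<otimes> v (n - i) \<ominus> x i \<otimes> y (n - i)) \<in> {..n} \<rightarrow> carrier R"
        using c1 c2 by auto
      have "(\<Oplus>i\<in>{..n}. u i \<otimes> v (n - i)) =
          (\<Oplus>i\<in>{..n}. (u i \<otimes> v (n - i) \<ominus> x i \<otimes> y (n - i)) \<oplus> x i \<otimes> y (n - i))"
      proof (rule finsum_cong')
        fix i assume "i \<in> {..n}"
        then have "u i \<otimes> v (n - i) \<in> carrier R" "x i \<otimes> y (n - i) \<in> carrier R" using c1 c2 by auto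
        then show "u i \<otimes> v (n - i) = (u i \<otimes> v (n - i) \<ominus> x i \<otimes> y (n - i)) \<oplus> x i \<otimes> y (n - i)"
          by (simp add: diff_add_cancel)
      qed (use c2 c3 in auto)
      also have "\<dots> = (\<Oplus>i\<in>{..n}. u i \<otimes> v (n - i) \<ominus> x i \<otimes> y (n - i)) \<oplus>
          (\<Oplus>i\<in>{..n}. x i \<otimes> y (n - i))"
        by (rule finsum_addf[OF c3 c2])
      finally have "(\<Oplus>i\<in>{..n}. u i \<otimes> v (n - i)) \<ominus> (\<Oplus>i\<in>{..n}. x i \<otimes> y (n - i))
          = (\<Oplus>i\<in>{..n}. u i \<otimes> v (n - i) \<ominus> x i \<otimes> y (n - i))"
        using add_diff_cancel[OF finsum_closed[OF c3] finsum_closed[OF c2]] by simp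
      moreover have "(\<Oplus>i\<in>{..n}. u i \<otimes> v (n - i) \<ominus> x i \<otimes> y (n - i)) \<in> IP (Suc n)"
        using d by (intro finsum_IP) auto
      ultimately show ?thesis
        unfolding cls_def * by (intro coset_eq_iff[THEN iffD2] finsum_closed[OF c1] finsum_closed[OF c2]) simp
    qed
    have xy: "x \<in> (\<Pi> i\<in>{..n}. cls x i)" "y \<in> (\<Pi> i\<in>{..n}. cls y i)"
    proof -
      have "z i \<in> cls z i" if "z \<in> reps" for z i
      proof -
        interpret J: ideal "IP (Suc i)" R by (rule IP_ideal)
        show ?thesis using J.a_rcos_self repsD(3)[OF that] by (simp add: cls_def)
      qed
      then show "x \<in> (\<Pi> i\<in>{..n}. cls x i)" "y \<in> (\<Pi> i\<in>{..n}. cls y i)" using assms by auto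
    qed
    show "(cls x \<otimes>\<^bsub>assoc_graded R I\<^esub> cls y) n = cls (x \<otimes>\<^bsub>UP R\<^esub> y) n"
      unfolding assoc_graded_def monoid.simps by (rule UN2_const[OF xy const])
  qed
  show "x \<otimes>\<^bsub>UP R\<^esub> y \<in> reps" unfolding reps_def
  proof (intro CollectI conjI allI)
    show "x \<otimes>\<^bsub>UP R\<^esub> y \<in> up R" unfolding * using up_mult_closed assms repsD by blast
    fix n
    have "x i \<otimes> y (n - i) \<in> IP n" if "i \<le> n" for i
      using IP_mult[OF repsD(1)[OF assms(1), of i] repsD(1)[OF assms(2), of "n - i"]] that by simp
    then show "(x \<otimes>\<^bsub>UP R\<^esub> y) n \<in> IP n" unfolding * by (intro finsum_IP) auto
  qed
qed

lemma cls_one: "\<one>\<^bsub>assoc_graded R I\<^esub> = cls \<one>\<^bsub>UP R\<^esub>" "\<one>\<^bsub>UP R\<^esub> \<in> reps"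
  and cls_zero: "\<zero>\<^bsub>assoc_graded R I\<^esub> = cls \<zero>\<^bsub>UP R\<^esub>" "\<zero>\<^bsub>UP R\<^esub> \<in> reps"
proof -
  have z: "\<zero> \<in> IP n" for n by (rule additive_subgroup.zero_closed[OF ideal.axioms(1)[OF IP_ideal]])
  have c: "IP n +> \<zero> = IP n" for n
    by (rule a_coset_add_zero) (use IP_carr in blast)
  show "\<one>\<^bsub>assoc_graded R I\<^esub> = cls \<one>\<^bsub>UP R\<^esub>" "\<zero>\<^bsub>assoc_graded R I\<^esub> = cls \<zero>\<^bsub>UP R\<^esub>"
    by (auto simp: assoc_graded_def cls_def UP_def fun_eq_iff c)
  show "\<one>\<^bsub>UP R\<^esub> \<in> reps" "\<zero>\<^bsub>UP R\<^esub> \<in> reps"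
    using z up_one_closed by (auto simp: reps_def UP_def intro!: mem_upI)
qed

lemma assoc_graded_cring: "cring (assoc_graded R I)"
proof -
  let ?G = "assoc_graded R I"
  interpret P: UP_cring R "UP R" by (simp add: UP_cring_def is_cring)
  have carr: "x \<in> carrier (UP R)" if "x \<in> reps" for x using repsD[OF that] by (simp add: UP_def)
  note simps = carrier_assoc_graded cls_add cls_mult cls_one cls_zero carr
  have comm: "cls (x \<oplus>\<^bsub>UP R\<^esub> y) = cls (y \<oplus>\<^bsub>UP R\<^esub> x)"
    "cls (x \<otimes>\<^bsub>UP R\<^esub> y) = cls (y \<otimes>\<^bsub>UP R\<^esub> x)" if "x \<in> reps" "y \<in> reps" for x y
    using P.P.a_comm[OF carr carr, OF that] P.P.m_comm[OF carr carr, OF that] by simp_all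
  show ?thesis
  proof (rule cringI)
    show "abelian_group ?G"
    proof (rule abelian_groupI)
      fix f assume "f \<in> carrier ?G"
      then obtain x where x: "x \<in> reps" "f = cls x" by (auto simp: carrier_assoc_graded)
      let ?y = "\<ominus>\<^bsub>UP R\<^esub> x"
      have "?y = (\<lambda>i. \<ominus> (x i))"
      proof -
        have 1: "(\<lambda>i. \<ominus> (x i)) \<in> carrier (UP R)"
          using up_a_inv_closed repsD(2)[OF x(1)] by (simp add: UP_def)
        have "(\<lambda>i. \<ominus> (x i)) \<oplus>\<^bsub>UP R\<^esub> x = \<zero>\<^bsub>UP R\<^esub>"
          using 1 carr[OF x(1)] repsD(3)[OF x(1)] by (simp add: UP_def l_neg)
        then show ?thesis using 1 carr[OF x(1)] P.P.minus_equality by blast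
      qed
      then have "?y \<in> reps"
        using up_a_inv_closed repsD[OF x(1)] additive_subgroup.a_inv_closed[OF ideal.axioms(1)[OF IP_ideal]]
        by (simp add: reps_def)
      moreover have "?y \<oplus>\<^bsub>UP R\<^esub> x = \<zero>\<^bsub>UP R\<^esub>" using carr[OF x(1)] by (rule P.P.l_neg)
      ultimately show "\<exists>y\<in>carrier ?G. y \<oplus>\<^bsub>?G\<^esub> f = \<zero>\<^bsub>?G\<^esub>"
        using x by (intro bexI[of _ "cls ?y"]) (auto simp: simps)
    qed (auto simp: simps P.P.a_assoc intro: comm)
    show "comm_monoid ?G"
      by (rule comm_monoidI) (auto simp: simps P.P.m_assoc intro: comm)
  qed (auto simp: simps P.P.l_distr)
qed

end

end

section \<open>Numerical semigroups and their tangent cones\<close>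

inductive_set generated_semigroup :: "nat set \<Rightarrow> nat set" for A where
  zero: "0 \<in> generated_semigroup A"
| add: "a \<in> A \<Longrightarrow> s \<in> generated_semigroup A \<Longrightarrow> a + s \<in> generated_semigroup A"

definition minimal_generators :: "nat set \<Rightarrow> nat set" where
  "minimal_generators \<Gamma> =
     {a \<in> \<Gamma>. a \<noteq> 0 \<and> (\<forall>x\<in>\<Gamma>. \<forall>y\<in>\<Gamma>. a = x + y \<longrightarrow> x = 0 \<or> y = 0)}"

text \<open>The ring \<open>K[[t\<^sup>a | a \<in> A]]\<close>: the image of \<open>\<Sum>\<^sub>\<alpha> c\<^sub>\<alpha> x\<^sup>\<alpha> \<in> K[[x\<^sub>a | a \<in> A]]\<close> under
  \<open>x\<^sub>a \<mapsto> t\<^sup>a\<close> has \<open>n\<close>-th coefficient \<open>\<Sum> c\<^sub>\<alpha>\<close> over all \<open>\<alpha>\<close> with \<open>\<Sum>\<^sub>a \<alpha>\<^sub>a a = n\<close>,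
  a finite sum if \<open>A\<close> is a finite set of positive integers.\<close>

definition power_series_subring :: "nat set \<Rightarrow> 'k::field fps ring" where
  "power_series_subring A =
     \<lparr>carrier = {f. \<exists>c. \<forall>n. fps_nth f n = (\<Sum>\<alpha> | \<alpha> \<in> A \<rightarrow>\<^sub>E UNIV \<and> (\<Sum>a\<in>A. \<alpha> a * a) = n. c \<alpha>)},
      mult = (*), one = 1, zero = 0, add = (+)\<rparr>"

definition monomial_ideal :: "nat set \<Rightarrow> 'k::field fps set" where
  "monomial_ideal A = genideal (power_series_subring A) ((\<lambda>a. fps_X ^ a) ` A)"

text \<open>The minimal generators are the canonical choice of \<open>a\<^sub>1 < \<dots> < a\<^sub>e\<close>; the theorem
  \<open>tangent_cone_generated\<close> below shows that every finite set of positive generators gives the same ring.\<close>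

definition tangent_cone :: "nat set \<Rightarrow> (nat \<Rightarrow> 'k::field fps set) ring" where
  "tangent_cone \<Gamma> =
     assoc_graded (power_series_subring (minimal_generators \<Gamma>))
       (monomial_ideal (minimal_generators \<Gamma>))"

subsection \<open>Independence of the chosen generators\<close>

lemma generated_semigroup_base: "a \<in> A \<Longrightarrow> a \<in> generated_semigroup A"
  using generated_semigroup.add[OF _ generated_semigroup.zero] by force

lemma generated_semigroup_plus:
  "x \<in> generated_semigroup A \<Longrightarrow> y \<in> generated_semigroup A \<Longrightarrow> x + y \<in> generated_semigroup A"
  by (induction rule: generated_semigroup.induct) (auto simp: add.assoc intro: generated_semigroup.intros)

lemma minimal_generators_subset: "minimal_generators (generated_semigroup A) \<subseteq> A"
proof
  fix a assume a: "a \<in> minimal_generators (generated_semigroup A)"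
  then have "a \<in> generated_semigroup A" by (simp add: minimal_generators_def)
  then show "a \<in> A" using a
  proof (induction rule: generated_semigroup.induct)
    case zero
    then show ?case by (simp add: minimal_generators_def)
  next
    case (add b s)
    then have "b = 0 \<or> s = 0"
      using generated_semigroup_base by (auto simp: minimal_generators_def)
    then show ?case using add by auto
  qed
qed

lemma generated_minimal_generators:
  "generated_semigroup (minimal_generators (generated_semigroup A)) = generated_semigroup A"
proof (intro equalityI subsetI)
  fix x assume "x \<in> generated_semigroup (minimal_generators (generated_semigroup A))"
  then show "x \<in> generated_semigroup A"
    by induction (use minimal_generators_subset in \<open>auto intro: generated_semigroup.intros\<close>)
next
  fix x assume "x \<in> generated_semigroup A"
  then show "x \<in> generated_semigroup (minimal_generators (generated_semigroup A))"
  proof (induction x rule: less_induct)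
    case (less x)
    show ?case
    proof (cases "x = 0 \<or> x \<in> minimal_generators (generated_semigroup A)")
      case True
      then show ?thesis using generated_semigroup_base generated_semigroup.zero by auto
    next
      case False
      then obtain y z where "y \<in> generated_semigroup A" "z \<in> generated_semigroup A"
        "x = y + z" "y \<noteq> 0" "z \<noteq> 0" using less.prems by (auto simp: minimal_generators_def)
      then show ?thesis using less.IH[of y] less.IH[of z] generated_semigroup_plus by simp
    qed
  qed
qed

lemma sum_in_generated_semigroup:
  assumes "finite B" "B \<subseteq> A"
  shows "(\<Sum>a\<in>B. \<alpha> a * a) \<in> generated_semigroup A"
  using assms
proof (induction B)
  case empty
  then show ?case by (simp add: generated_semigroup.zero)
next
  case (insert b B)
  have "k * b \<in> generated_semigroup A" for k
    using insert.prems by (induction k) (auto intro: generated_semigroup.intros)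
  then show ?case using insert generated_semigroup_plus by simp
qed

lemma generated_semigroup_sum:
  assumes "finite A" "n \<in> generated_semigroup A"
  shows "\<exists>\<alpha>. \<alpha> \<in> A \<rightarrow>\<^sub>E (UNIV :: nat set) \<and> (\<Sum>a\<in>A. \<alpha> a * a) = n"
  using assms(2)
proof induction
  case zero
  then show ?case by (intro exI[of _ "\<lambda>a\<in>A. 0"]) auto
next
  case (add b s)
  then obtain \<alpha> where \<alpha>: "\<alpha> \<in> A \<rightarrow>\<^sub>E (UNIV :: nat set)" "(\<Sum>a\<in>A. \<alpha> a * a) = s" by blast
  have "(\<Sum>a\<in>A. (\<alpha>(b := Suc (\<alpha> b))) a * a) = (\<Sum>a\<in>A. \<alpha> a * a + (if a = b then b else 0))"
    by (rule sum.cong) auto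
  also have "\<dots> = b + s" using \<alpha> add.hyps assms(1) by (simp add: sum.distrib)
  finally show ?case using \<alpha>(1) add.hyps by (intro exI[of _ "\<alpha>(b := Suc (\<alpha> b))"]) (auto simp: PiE_def extensional_def)
qed

lemma carrier_power_series_subring:
  assumes "finite A" "0 \<notin> A"
  shows "carrier (power_series_subring A :: 'k::field fps ring)
    = {f. \<forall>n. fps_nth f n \<noteq> 0 \<longrightarrow> n \<in> generated_semigroup A}"
proof (intro equalityI subsetI CollectI allI impI)
  fix f :: "'k fps" and n
  assume "f \<in> carrier (power_series_subring A)" "fps_nth f n \<noteq> 0"
  then obtain c where "(\<Sum>\<alpha> | \<alpha> \<in> A \<rightarrow>\<^sub>E UNIV \<and> (\<Sum>a\<in>A. \<alpha> a * a) = n. c \<alpha>) \<noteq> (0::'k)"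
    by (auto simp: power_series_subring_def)
  then have "{\<alpha>. \<alpha> \<in> A \<rightarrow>\<^sub>E (UNIV::nat set) \<and> (\<Sum>a\<in>A. \<alpha> a * a) = n} \<noteq> {}" by force
  then show "n \<in> generated_semigroup A" using sum_in_generated_semigroup assms by blast
next
  fix f :: "'k fps"
  assume f: "f \<in> {f. \<forall>n. fps_nth f n \<noteq> 0 \<longrightarrow> n \<in> generated_semigroup A}"
  obtain \<phi> where \<phi>: "\<And>n. n \<in> generated_semigroup A \<Longrightarrow>
      \<phi> n \<in> A \<rightarrow>\<^sub>E (UNIV :: nat set) \<and> (\<Sum>a\<in>A. \<phi> n a * a) = n"
    using generated_semigroup_sum[OF assms(1)] by metis
  define c where "c \<alpha> = (let n = \<Sum>a\<in>A. \<alpha> a * a in if \<alpha> = \<phi> n then fps_nth f n else 0)" for \<alpha>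
  have "fps_nth f n = (\<Sum>\<alpha> | \<alpha> \<in> A \<rightarrow>\<^sub>E UNIV \<and> (\<Sum>a\<in>A. \<alpha> a * a) = n. c \<alpha>)" for n
  proof -
    let ?S = "{\<alpha>. \<alpha> \<in> A \<rightarrow>\<^sub>E (UNIV::nat set) \<and> (\<Sum>a\<in>A. \<alpha> a * a) = n}"
    have "?S \<subseteq> A \<rightarrow>\<^sub>E {..n}"
    proof
      fix \<alpha> assume \<alpha>: "\<alpha> \<in> ?S"
      have "\<alpha> a \<le> n" if "a \<in> A" for a
      proof -
        have "\<alpha> a \<le> \<alpha> a * a" using that assms(2) by (cases a) auto
        also have "\<dots> \<le> (\<Sum>a\<in>A. \<alpha> a * a)" using that assms(1) by (intro member_le_sum) auto
        finally show ?thesis using \<alpha> by simp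
      qed
      then show "\<alpha> \<in> A \<rightarrow>\<^sub>E {..n}" using \<alpha> by (auto simp: PiE_def)
    qed
    moreover have "finite (A \<rightarrow>\<^sub>E {..n})" using assms(1) by (intro finite_PiE) auto
    ultimately have fin: "finite ?S" by (rule finite_subset)
    have "(\<Sum>\<alpha>\<in>?S. c \<alpha>) = (\<Sum>\<alpha>\<in>?S. if \<alpha> = \<phi> n then fps_nth f n else 0)"
      by (rule sum.cong) (auto simp: c_def)
    also have "\<dots> = (if \<phi> n \<in> ?S then fps_nth f n else 0)" using fin by simp
    also have "\<dots> = fps_nth f n" using \<phi>[of n] f by auto
    finally show ?thesis by simp
  qed
  then show "f \<in> carrier (power_series_subring A)" by (auto simp: power_series_subring_def)
qed

lemma power_series_subring_sel [simp]:
  "monoid.mult (power_series_subring A) = (*)" "one (power_series_subring A) = 1"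
  "zero (power_series_subring A) = 0" "add (power_series_subring A) = (+)"
  by (simp_all add: power_series_subring_def)

lemma power_series_subring_cring:
  assumes "finite A" "0 \<notin> A"
  shows "cring (power_series_subring A :: 'k::field fps ring)"
proof -
  let ?R = "power_series_subring A :: 'k fps ring"
  note c = carrier_power_series_subring[OF assms, where 'k = 'k]
  have mult: "f * g \<in> carrier ?R" if "f \<in> carrier ?R" "g \<in> carrier ?R" for f g
  proof -
    have "n \<in> generated_semigroup A" if n: "fps_nth (f * g) n \<noteq> 0" for n
    proof -
      obtain i where i: "i \<le> n" "fps_nth f i * fps_nth g (n - i) \<noteq> 0"
        using n unfolding fps_mult_nth by (metis (no_types, lifting) atLeastAtMost_iff sum.neutral)
      then have "i \<in> generated_semigroup A" "n - i \<in> generated_semigroup A"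
        using \<open>f \<in> carrier ?R\<close> \<open>g \<in> carrier ?R\<close> unfolding c by auto
      then have "i + (n - i) \<in> generated_semigroup A" by (rule generated_semigroup_plus)
      then show ?thesis using i by simp
    qed
    then show ?thesis unfolding c by blast
  qed
  have add: "f + g \<in> carrier ?R" if "f \<in> carrier ?R" "g \<in> carrier ?R" for f g
  proof -
    have "fps_nth f n \<noteq> 0 \<or> fps_nth g n \<noteq> 0" if "fps_nth (f + g) n \<noteq> 0" for n
      using that by auto
    then show ?thesis using that unfolding c by blast
  qed
  have one: "1 \<in> carrier ?R" unfolding c by (auto simp: generated_semigroup.zero fps_one_nth)
  have zero: "0 \<in> carrier ?R" unfolding c by auto
  have uminus: "- f \<in> carrier ?R" if "f \<in> carrier ?R" for f using that unfolding c by auto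
  show ?thesis
  proof (rule cringI)
    show "abelian_group ?R"
    proof (rule abelian_groupI)
      fix f assume "f \<in> carrier ?R"
      then show "\<exists>g\<in>carrier ?R. g \<oplus>\<^bsub>?R\<^esub> f = \<zero>\<^bsub>?R\<^esub>"
        using uminus by (intro bexI[of _ "- f"]) auto
    qed (auto simp: add zero algebra_simps)
    show "comm_monoid ?R"
      by (rule comm_monoidI) (auto simp: mult one algebra_simps)
  qed (auto simp: algebra_simps)
qed

lemma monomial_ideal_eq:
  assumes "finite A" "0 \<notin> A"
  shows "(monomial_ideal A :: 'k::field fps set)
    = {f \<in> carrier (power_series_subring A). fps_nth f 0 = 0}" (is "_ = ?M")
proof -
  let ?R = "power_series_subring A :: 'k fps ring"
  interpret cring ?R by (rule power_series_subring_cring[OF assms])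
  note c = carrier_power_series_subring[OF assms, where 'k = 'k]
  let ?G = "generated_semigroup A"
  have gens: "(\<lambda>a. fps_X ^ a) ` A \<subseteq> ?M"
    using assms generated_semigroup_base unfolding c
    by (auto simp: fps_X_power_nth split: if_splits) (metis gr0I)
  have "ideal ?M ?R"
  proof (rule idealI)
    show "subgroup ?M (add_monoid ?R)"
    proof (rule add.subgroupI)
      fix f assume f: "f \<in> ?M"
      have "\<ominus>\<^bsub>?R\<^esub> f = - f"
        using f unfolding c by (intro minus_equality) (auto simp: c)
      then have "\<ominus>\<^bsub>?R\<^esub> f \<in> ?M" using f unfolding c by auto
      then show "\<ominus>\<^bsub>?R\<^esub> f \<in> ?M" .
    next
      fix f g assume "f \<in> ?M" "g \<in> ?M"
      then show "f \<oplus>\<^bsub>?R\<^esub> g \<in> ?M" using add.m_closed[of f g] by auto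
    qed (use zero_closed in auto)
  next
    fix f g assume "f \<in> ?M" "g \<in> carrier ?R"
    then show "g \<otimes>\<^bsub>?R\<^esub> f \<in> ?M" "f \<otimes>\<^bsub>?R\<^esub> g \<in> ?M"
      using m_closed[of f g] m_closed[of g f] by auto
  qed (rule ring_axioms)
  then have 1: "monomial_ideal A \<subseteq> ?M"
    unfolding monomial_ideal_def using gens by (intro genideal_minimal) auto
  have "f \<in> monomial_ideal A" if f: "f \<in> ?M" for f
  proof -
    interpret J: ideal "monomial_ideal A" ?R
      unfolding monomial_ideal_def using gens by (intro genideal_ideal) auto
    have "\<exists>a\<in>A. a \<le> n \<and> n - a \<in> ?G" if "n \<in> ?G" "n \<noteq> 0" for n
      using that(1)
    proof cases
      case (add a s)
      then show ?thesis by (intro bexI[of _ a]) auto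
    qed (use that(2) in simp)
    then obtain sel where sel: "\<And>n. n \<in> ?G \<Longrightarrow> n \<noteq> 0 \<Longrightarrow> sel n \<in> A \<and> sel n \<le> n \<and> n - sel n \<in> ?G"
      by metis
    define g where "g a = Abs_fps (\<lambda>k. if sel (k + a) = a then fps_nth f (k + a) else 0)" for a
    have g: "g a \<in> carrier ?R" if "a \<in> A" for a
    proof -
      have "k \<in> ?G" if k: "fps_nth (g a) k \<noteq> 0" for k
      proof -
        have "sel (k + a) = a" "fps_nth f (k + a) \<noteq> 0" using k by (auto simp: g_def split: if_splits)
        then show ?thesis using sel[of "k + a"] f \<open>a \<in> A\<close> assms(2) unfolding c by auto
      qed
      then show ?thesis unfolding c by blast
    qed
    have "f = (\<Sum>a\<in>A. fps_X ^ a * g a)"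
    proof (rule fps_ext)
      fix n
      have "fps_nth (\<Sum>a\<in>A. fps_X ^ a * g a) n
          = (\<Sum>a\<in>A. if n < a then 0 else if sel n = a then fps_nth f n else 0)"
        unfolding fps_sum_nth by (rule sum.cong) (auto simp: fps_X_power_mult_nth g_def)
      also have "\<dots> = fps_nth f n"
      proof (cases "fps_nth f n = 0")
        case False
        then have "n \<in> ?G" "n \<noteq> 0" using f unfolding c by (auto intro: gr0I)
        then have s: "sel n \<in> A" "sel n \<le> n" using sel by auto
        have "(\<Sum>a\<in>A. if n < a then 0 else if sel n = a then fps_nth f n else 0)
            = (\<Sum>a\<in>A. if sel n = a then fps_nth f n else 0)"
          by (rule sum.cong) (use s in auto)
        then show ?thesis using s assms(1) by simp
      qed (simp add: sum.neutral)
      finally show "fps_nth f n = fps_nth (\<Sum>a\<in>A. fps_X ^ a * g a) n" by simp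
    qed
    moreover have "(\<Sum>a\<in>B. fps_X ^ a * g a) \<in> monomial_ideal A" if "B \<subseteq> A" for B
      using finite_subset[OF that assms(1)] that
    proof (induction B)
      case empty
      then show ?case using J.zero_closed by simp
    next
      case (insert b B)
      have "fps_X ^ b \<in> (monomial_ideal A :: 'k fps set)"
        using genideal_self[of "(\<lambda>a. fps_X ^ a) ` A"] gens insert.prems
        unfolding monomial_ideal_def by auto
      then have "fps_X ^ b * g b \<in> monomial_ideal A"
        using J.I_r_closed g insert.prems by auto
      then show ?case using insert J.a_closed by auto
    qed
    ultimately show ?thesis by auto
  qed
  with 1 show ?thesis by blast
qed

theorem tangent_cone_generated:
  assumes "finite A" "0 \<notin> A"
  shows "(tangent_cone (generated_semigroup A) :: (nat \<Rightarrow> 'k::field fps set) ring)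
    = assoc_graded (power_series_subring A) (monomial_ideal A)"
proof -
  let ?B = "minimal_generators (generated_semigroup A)"
  have B: "finite ?B" "0 \<notin> ?B"
    using minimal_generators_subset finite_subset assms by blast+
  have "carrier (power_series_subring ?B :: 'k fps ring) = carrier (power_series_subring A)"
    unfolding carrier_power_series_subring[OF B] carrier_power_series_subring[OF assms]
      generated_minimal_generators ..
  then have R: "(power_series_subring ?B :: 'k fps ring) = power_series_subring A"
    by (simp add: power_series_subring_def)
  moreover have "(monomial_ideal ?B :: 'k fps set) = monomial_ideal A"
    unfolding monomial_ideal_eq[OF B] monomial_ideal_eq[OF assms] R ..
  ultimately show ?thesis by (simp add: tangent_cone_def)
qed

end

theory Submission
  imports Defs
begin

text \<open>The idea is to find a nonzero element \<open>u\<close> of the tangent cone \<open>G\<close> that is annihilated by the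
  irrelevant maximal ideal \<open>M\<close>. Then every nonunit of the local ring
  \<open>G\<^sub>M\<close> kills the nonzero element \<open>u / 1\<close>, so that \<open>G\<^sub>M\<close> has depth \<open>0\<close>. On the other hand its dimension is
  positive, because \<open>M\<close> properly contains the kernel of the surjection \<open>G \<rightarrow> K[T]\<close> sending the class of
  \<open>t\<^sup>m\<close> to \<open>T\<close> and the classes of the other generators to \<open>0\<close> (\<open>Min_part\<close>). That such a configuration is
  incompatible with the Cohen--Macaulay property is \<open>not_cohen_macaulay_if_annihilated\<close>.

  The element \<open>u\<close> is the class of a monomial \<open>t\<^sup>s\<close>. Let the order of \<open>s \<in> \<Gamma>\<close> be the largest number
  of generators, with repetition, that sum up to \<open>s\<close>. The class of \<open>t\<^sup>s\<close> in degree \<open>n = ord s\<close> is nonzero, and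
  it is killed by the class of \<open>t\<^sup>a\<close> if \<open>ord (s + a) \<ge> n + 2\<close>. So an \<open>s\<close> for which the order jumps by
  at least two at every generator suffices (\<open>not_cohen_macaulay_if_order_jumps\<close>).

  Write \<open>g\<^sub>i = (q + 1) m + (q + i) d\<close>. Already the generator \<open>g\<^sub>2\<close>, of order \<open>1\<close>, jumps at all
  generators but \<open>m + d\<close>, by the relations
    \<open>g\<^sub>2 + m = (q + 2) (m + d)\<close>,
    \<open>g\<^sub>2 + g\<^sub>j = g\<^sub>j\<^sub>+\<^sub>1 + (q + 1) (m + d)\<close> for \<open>j < e - 1\<close>, and
    \<open>g\<^sub>2 + g\<^sub>e\<^sub>-\<^sub>1 = (2 q + 2 + d) m\<close>,
  the last one because \<open>m = e + 2 q + 1\<close>. Adding multiples of \<open>m + d\<close> does not destroy these jumps. As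
  \<open>m (m + d) = (m + d) m\<close> has order greater than \<open>m\<close>, the order of \<open>g\<^sub>2 + k (m + d)\<close> cannot remain
  \<open>k + 1\<close> for all \<open>k\<close>; just before it first exceeds \<open>k + 1\<close> there is a jump at \<open>m + d\<close> as well.\<close>

section \<open>Local rings of depth zero\<close>

context cring
begin

lemma idealI_closed:
  assumes "J \<subseteq> carrier R" "\<zero> \<in> J" "\<And>a b. a \<in> J \<Longrightarrow> b \<in> J \<Longrightarrow> a \<oplus> b \<in> J"
    "\<And>a r. a \<in> J \<Longrightarrow> r \<in> carrier R \<Longrightarrow> r \<otimes> a \<in> J"
  shows "ideal J R"
proof (rule idealI)
  show "subgroup J (add_monoid R)"
  proof (rule add.subgroupI)
    fix a assume a: "a \<in> J"
    have "(\<ominus> \<one>) \<otimes> a \<in> J" using assms(4)[OF a, of "\<ominus> \<one>"] by simp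
    then show "\<ominus> a \<in> J" using a assms(1) by (simp add: l_minus subset_iff)
  qed (use assms in auto)
  fix a r assume a: "a \<in> J" "r \<in> carrier R"
  then show "r \<otimes> a \<in> J" "a \<otimes> r \<in> J" using assms(1,4) m_comm[of a r] by auto
qed (rule ring_axioms)

lemma additive_zero_minus:
  fixes \<phi> :: "'a \<Rightarrow> 'c::ab_group_add"
  assumes "\<And>a b. a \<in> carrier R \<Longrightarrow> b \<in> carrier R \<Longrightarrow> \<phi> (a \<oplus> b) = \<phi> a + \<phi> b"
  shows "\<phi> \<zero> = 0" "a \<in> carrier R \<Longrightarrow> \<phi> (\<ominus> a) = - \<phi> a"
proof -
  show 0: "\<phi> \<zero> = 0" using assms[of \<zero> \<zero>] by simp
  show "a \<in> carrier R \<Longrightarrow> \<phi> (\<ominus> a) = - \<phi> a"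
    using assms[of "\<ominus> a" a] 0 by (simp add: l_neg eq_neg_iff_add_eq_0)
qed

lemma primeideal_kernel:
  fixes \<phi> :: "'a \<Rightarrow> 'c::idom"
  assumes add: "\<And>a b. a \<in> carrier R \<Longrightarrow> b \<in> carrier R \<Longrightarrow> \<phi> (a \<oplus> b) = \<phi> a + \<phi> b"
    and mult: "\<And>a b. a \<in> carrier R \<Longrightarrow> b \<in> carrier R \<Longrightarrow> \<phi> (a \<otimes> b) = \<phi> a * \<phi> b"
    and one: "\<phi> \<one> = 1"
  shows "primeideal {a \<in> carrier R. \<phi> a = 0} R"
proof (rule primeidealI)
  have "\<phi> \<zero> = 0" by (rule additive_zero_minus(1)) (rule add)
  then show "ideal {a \<in> carrier R. \<phi> a = 0} R"
    by (intro idealI_closed) (auto simp: add mult)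
  show "carrier R \<noteq> {a \<in> carrier R. \<phi> a = 0}" using one by force
qed (auto simp: mult is_cring)

lemma maximalideal_kernel:
  fixes \<phi> :: "'a \<Rightarrow> 'c::field"
  assumes add: "\<And>a b. a \<in> carrier R \<Longrightarrow> b \<in> carrier R \<Longrightarrow> \<phi> (a \<oplus> b) = \<phi> a + \<phi> b"
    and mult: "\<And>a b. a \<in> carrier R \<Longrightarrow> b \<in> carrier R \<Longrightarrow> \<phi> (a \<otimes> b) = \<phi> a * \<phi> b"
    and one: "\<phi> \<one> = 1" and surj: "\<And>c. \<exists>a\<in>carrier R. \<phi> a = c"
  shows "maximalideal {a \<in> carrier R. \<phi> a = 0} R" (is "maximalideal ?M R")
proof (rule maximalidealI)
  have one_minus: "\<phi> (\<one> \<oplus> \<ominus> (b \<otimes> f)) = 1 - \<phi> b * \<phi> f"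
    if "b \<in> carrier R" "f \<in> carrier R" for b f
  proof -
    have "\<phi> (\<ominus> (b \<otimes> f)) = - \<phi> (b \<otimes> f)"
      using that by (intro additive_zero_minus(2) add) auto
    then show ?thesis using that add[of \<one> "\<ominus> (b \<otimes> f)"] mult[of b f] one by simp
  qed
  have M: "primeideal ?M R" by (rule primeideal_kernel) (fact add mult one)+
  show "ideal ?M R" by (rule primeideal.axioms(1)[OF M])
  show "carrier R \<noteq> ?M" by (rule primeideal.I_notcarr[OF M])
  fix J assume J: "ideal J R" "?M \<subseteq> J" "J \<subseteq> carrier R"
  interpret J: ideal J R by fact
  show "J = ?M \<or> J = carrier R"
  proof (cases "J = ?M")
    case False
    then obtain f where f: "f \<in> J" "\<phi> f \<noteq> 0" "f \<in> carrier R" using J by blast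
    obtain b where b: "b \<in> carrier R" "\<phi> b = inverse (\<phi> f)" using surj by blast
    have "\<phi> (\<one> \<oplus> \<ominus> (b \<otimes> f)) = 0"
      unfolding one_minus[OF b(1) f(3)] b(2) using f(2) by simp
    then have "\<one> \<oplus> \<ominus> (b \<otimes> f) \<in> J" using f b J(2) by auto
    then have "(\<one> \<oplus> \<ominus> (b \<otimes> f)) \<oplus> b \<otimes> f \<in> J" using J.I_l_closed f b J.a_closed by blast
    then have "\<one> \<in> J" using f b by (simp add: a_assoc l_neg)
    then show ?thesis using J.one_imp_carrier by blast
  qed (rule disjI1)
qed

end

context mult_subset
begin

text \<open>For a prime ideal \<open>P\<close> that avoids \<open>S\<close>, the numerators of the elements of its extension all lie in
  \<open>P\<close>, whichever fraction is chosen. So inclusions between such primes remain strict after localization.\<close>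

abbreviation "extension P \<equiv> {fraction R S a s | a s. a \<in> P \<and> s \<in> S}"

lemma fraction_in_extension_iff:
  assumes "primeideal P R" "P \<inter> S = {}" "a \<in> carrier R" "s \<in> S"
  shows "fraction R S a s \<in> extension P \<longleftrightarrow> a \<in> P"
proof
  interpret primeideal P R by fact
  assume "fraction R S a s \<in> extension P"
  then obtain b u where b: "b \<in> P" "u \<in> S" "fraction R S a s = fraction R S b u" by blast
  then obtain v where v: "v \<in> S" "v \<otimes> (u \<otimes> a) = v \<otimes> (s \<otimes> b)"
    using fraction_eq_iff assms(3,4) Icarr by metis
  have "v \<otimes> (s \<otimes> b) \<in> P" using b v assms(4) by (intro I_l_closed) auto
  then have "v \<otimes> (u \<otimes> a) \<in> P" using v by simp
  then have "v \<in> P \<or> u \<in> P \<or> a \<in> P" using v b assms(3) I_prime[of v "u \<otimes> a"] I_prime[of u a] by auto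
  then show "a \<in> P" using assms(2) v b by blast
qed (use assms in blast)

lemma primeideal_extension:
  assumes "primeideal P R" "P \<inter> S = {}"
  shows "primeideal (extension P) (localization R S)"
proof (rule primeidealI)
  let ?L = "localization R S"
  interpret P: primeideal P R by fact
  interpret L: cring ?L by (rule localization_cring)
  show "cring ?L" by (rule localization_cring)
  have [simp]: "a \<in> P \<Longrightarrow> a \<in> carrier R" for a by (rule P.Icarr)
  note iff = fraction_in_extension_iff[OF assms]
  show "ideal (extension P) ?L"
  proof (rule L.idealI_closed)
    show "extension P \<subseteq> carrier ?L" using fraction_carrier P.Icarr by blast
    show "\<zero>\<^bsub>?L\<^esub> \<in> extension P" using S_one P.zero_closed unfolding localization_zero by blast
    fix X Y assume "X \<in> extension P" "Y \<in> extension P"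
    then show "X \<oplus>\<^bsub>?L\<^esub> Y \<in> extension P"
      by (auto simp: fraction_add) (metis P.I_l_closed P.a_closed S_carr S_mult)
  next
    fix X Y assume "X \<in> extension P" "Y \<in> carrier ?L"
    then show "Y \<otimes>\<^bsub>?L\<^esub> X \<in> extension P"
      by (auto simp: fraction_mult elim!: localization_carrierE) (metis P.I_l_closed S_mult)
  qed
  have "\<one>\<^bsub>?L\<^esub> \<notin> extension P" using iff[of \<one> \<one>] S_one assms(2) localization_one by auto
  then show "carrier ?L \<noteq> extension P" using L.one_closed by metis
  fix X Y assume "X \<in> carrier ?L" "Y \<in> carrier ?L" "X \<otimes>\<^bsub>?L\<^esub> Y \<in> extension P"
  then obtain a s b u where "a \<in> carrier R" "s \<in> S" "X = fraction R S a s"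
    "b \<in> carrier R" "u \<in> S" "Y = fraction R S b u" "fraction R S (a \<otimes> b) (s \<otimes> u) \<in> extension P"
    by (metis (no_types, lifting) fraction_mult localization_carrierE)
  then show "X \<in> extension P \<or> Y \<in> extension P"
    using iff[of "a \<otimes> b" "s \<otimes> u"] P.I_prime[of a b] S_mult by blast
qed

lemma krull_dim_localization_pos:
  assumes "primeideal P R" "primeideal Q R" "P \<subset> Q" "Q \<inter> S = {}"
  shows "krull_dim (localization R S) \<ge> 1"
proof -
  have PS: "P \<inter> S = {}" using assms by blast
  obtain a where a: "a \<in> Q" "a \<notin> P" using assms(3) by blast
  interpret Q: primeideal Q R by fact
  have "fraction R S a \<one> \<in> extension Q" using a S_one by blast
  moreover have "fraction R S a \<one> \<notin> extension P"
    using fraction_in_extension_iff[OF assms(1) PS] a Q.Icarr S_one by blast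
  ultimately have "extension P \<subset> extension Q" using assms(3) by blast
  then have "\<exists>F. (\<forall>i\<le>1. primeideal (F i) (localization R S)) \<and> (\<forall>i<1::nat. F i \<subset> F (Suc i))"
    using primeideal_extension[OF assms(1) PS] primeideal_extension[OF assms(2,4)]
    by (intro exI[of _ "\<lambda>i. if i = 0 then extension P else extension Q"]) auto
  then have "enat 1 \<le> krull_dim (localization R S)"
    unfolding krull_dim_def by (intro Sup_upper) blast
  then show ?thesis by (simp add: one_enat_def)
qed

end

text \<open>The annihilator of \<open>u\<close> is a proper ideal containing \<open>M\<close>, hence equal to \<open>M\<close>; therefore \<open>u / 1\<close> is
  nonzero in the localization. A nonunit there has its numerator in \<open>M\<close>, so it kills \<open>u / 1\<close> and cannot
  be the first term of a regular sequence.\<close>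

lemma (in cring) depth_localization_eq_0:
  assumes "maximalideal M R" "u \<in> carrier R" "u \<noteq> \<zero>" "\<And>c. c \<in> M \<Longrightarrow> c \<otimes> u = \<zero>"
  defines "L \<equiv> localization R (carrier R - M)"
  shows "depth L (carrier L - Units L) = 0"
proof -
  interpret M: maximalideal M R by fact
  have prime: "primeideal M R" by (rule maximalideal_prime[OF assms(1)])
  interpret mult_subset R "carrier R - M" by (rule prime_complement_mult_subset[OF prime])
  interpret L: cring L unfolding L_def by (rule localization_cring)
  have ann: "ideal {a \<in> carrier R. a \<otimes> u = \<zero>} R"
    by (rule idealI_closed) (use assms(2) in \<open>auto simp: l_distr m_assoc\<close>)
  have "M \<subseteq> {a \<in> carrier R. a \<otimes> u = \<zero>}" using assms(4) M.Icarr by auto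
  then have "{a \<in> carrier R. a \<otimes> u = \<zero>} = M \<or> {a \<in> carrier R. a \<otimes> u = \<zero>} = carrier R"
    using M.I_maximal[OF ann] by blast
  moreover have "\<one> \<notin> {a \<in> carrier R. a \<otimes> u = \<zero>}" using assms(2,3) by simp
  ultimately have annM: "{a \<in> carrier R. a \<otimes> u = \<zero>} = M" using one_closed by blast
  have u1: "fraction R (carrier R - M) u \<one> \<noteq> \<zero>\<^bsub>L\<^esub>"
  proof
    assume "fraction R (carrier R - M) u \<one> = \<zero>\<^bsub>L\<^esub>"
    then obtain v where v: "v \<in> carrier R - M" "v \<otimes> (\<one> \<otimes> u) = v \<otimes> (\<one> \<otimes> \<zero>)"
      unfolding L_def localization_zero using fraction_eq_iff S_one assms(2) by auto
    then show False using annM assms(2) by auto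
  qed
  have "xs = []" if reg: "regular_sequence L xs" and sub: "set xs \<subseteq> carrier L - Units L" for xs
  proof (rule ccontr)
    assume "xs \<noteq> []"
    then have len: "0 < length xs" and hd: "xs ! 0 \<in> carrier L - Units L"
      using sub nth_mem by blast+
    then obtain a s where as: "a \<in> carrier R" "s \<in> carrier R - M" "xs ! 0 = fraction R (carrier R - M) a s"
      unfolding L_def by (auto elim: localization_carrierE)
    have "a \<in> M"
    proof (rule ccontr)
      assume "a \<notin> M"
      then have a: "a \<in> carrier R - M" using as by blast
      have "fraction R (carrier R - M) a s \<otimes>\<^bsub>L\<^esub> fraction R (carrier R - M) s a = \<one>\<^bsub>L\<^esub>"
        unfolding L_def using a as S_mult[OF a as(2)] S_mult[OF as(2) a] S_one
        by (simp only: fraction_mult localization_one S_carr) (rule fraction_eqI1, auto simp: m_comm)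
      moreover have "fraction R (carrier R - M) s a \<in> carrier L"
        unfolding L_def using a as by (simp add: fraction_carrier)
      ultimately have "xs ! 0 \<in> Units L" using hd as(3) L.m_comm
        unfolding Units_def by (auto intro!: bexI[of _ "fraction R (carrier R - M) s a"])
      then show False using hd by blast
    qed
    then have "fraction R (carrier R - M) a s \<otimes>\<^bsub>L\<^esub> fraction R (carrier R - M) u \<one> = \<zero>\<^bsub>L\<^esub>"
      unfolding L_def using as assms(2,4) S_one
      by (simp add: fraction_mult localization_zero) (rule fraction_eqI1, auto)
    then have "xs ! 0 \<otimes>\<^bsub>L\<^esub> fraction R (carrier R - M) u \<one> \<in> genideal L (set (take 0 xs))"
      using as(3) L.genideal_ideal[of "{}"] additive_subgroup.zero_closed ideal.axioms(1) by fastforce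
    moreover have "fraction R (carrier R - M) u \<one> \<in> carrier L"
      unfolding L_def using assms(2) S_one by (simp add: fraction_carrier)
    ultimately have "fraction R (carrier R - M) u \<one> \<in> genideal L {}"
      using reg len unfolding regular_sequence_def by fastforce
    moreover have "genideal L {} \<subseteq> {\<zero>\<^bsub>L\<^esub>}"
      using L.genideal_minimal[OF L.zeroideal, of "{}"] by simp
    ultimately show False using u1 by blast
  qed
  then have "depth L (carrier L - Units L) \<le> 0"
    unfolding depth_def by (intro Sup_least) (auto simp: zero_enat_def)
  then show ?thesis by simp
qed

lemma (in cring) not_cohen_macaulay_if_annihilated:
  assumes M: "maximalideal M R" and P: "primeideal P R" "P \<subset> M"
    and u: "u \<in> carrier R" "u \<noteq> \<zero>" "\<And>c. c \<in> M \<Longrightarrow> c \<otimes> u = \<zero>"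
  shows "\<not> cohen_macaulay R"
proof
  assume "cohen_macaulay R"
  then have "cohen_macaulay_local (localization R (carrier R - M))"
    using M unfolding cohen_macaulay_def by blast
  then have "krull_dim (localization R (carrier R - M)) = 0"
    unfolding cohen_macaulay_local_def using depth_localization_eq_0[OF M u] by simp
  moreover have prime: "primeideal M R" by (rule maximalideal_prime[OF M])
  interpret mult_subset R "carrier R - M" by (rule prime_complement_mult_subset[OF prime])
  have "krull_dim (localization R (carrier R - M)) \<ge> 1"
    by (rule krull_dim_localization_pos[OF P(1) prime P(2)]) blast
  ultimately show False by simp
qed

section \<open>Homogeneous elements of the associated graded ring\<close>

context graded
begin

(* The simplifier would rewrite the power of exponent Suc n, and the facts below, which are stated for
   folded powers, would no longer apply. *)
context
  notes nat_pow_Suc [simp del] Group.nat_pow_Suc [simp del]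
    and nat_pow_0 [simp del] Group.nat_pow_0 [simp del]
begin

definition homogeneous :: "nat \<Rightarrow> 'a \<Rightarrow> nat \<Rightarrow> 'a set" where
  "homogeneous n h = cls (\<lambda>i. if i = n then h else \<zero>)"

lemma IP_zero: "\<zero> \<in> IP n"
  by (rule additive_subgroup.zero_closed[OF ideal.axioms(1)[OF IP_ideal]])

lemma IP_antimono: "i \<le> j \<Longrightarrow> IP j \<subseteq> IP i"
  by (rule lift_Suc_antimono_le[of IP]) (rule IP_Suc_subset)

lemma single_reps: "h \<in> IP n \<Longrightarrow> (\<lambda>i. if i = n then h else \<zero>) \<in> reps"
  using IP_zero IP_carr unfolding reps_def by (auto intro!: mem_upI exI[of _ n] bound.intro)

lemma homogeneous_carrier: "h \<in> IP n \<Longrightarrow> homogeneous n h \<in> carrier (assoc_graded R I)"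
  using single_reps by (auto simp: homogeneous_def carrier_assoc_graded)

lemma cls_eq_zero_iff:
  assumes "x \<in> reps"
  shows "cls x = \<zero>\<^bsub>assoc_graded R I\<^esub> \<longleftrightarrow> (\<forall>n. x n \<in> IP (Suc n))"
proof -
  have "IP (Suc n) +> x n = IP (Suc n) \<longleftrightarrow> x n \<in> IP (Suc n)" for n
    using a_rcos_zero[OF IP_ideal] ideal.rcos_const_imp_mem[OF IP_ideal] repsD(3)[OF assms] by metis
  then show ?thesis by (simp add: fun_eq_iff cls_def assoc_graded_def)
qed

lemma homogeneous_nonzero:
  assumes "h \<in> IP n" "h \<notin> IP (Suc n)"
  shows "homogeneous n h \<noteq> \<zero>\<^bsub>assoc_graded R I\<^esub>"
  unfolding homogeneous_def using cls_eq_zero_iff[OF single_reps[OF assms(1)]] assms(2)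
  by (auto intro: exI[of _ n])

lemma cls_mult_homogeneous_zero:
  assumes x: "x \<in> reps" and h: "h \<in> IP n" and xh: "\<And>i. x i \<otimes> h \<in> IP (Suc (i + n))"
  shows "cls x \<otimes>\<^bsub>assoc_graded R I\<^esub> homogeneous n h = \<zero>\<^bsub>assoc_graded R I\<^esub>"
proof -
  let ?y = "\<lambda>i. if i = n then h else \<zero>"
  have y: "?y \<in> reps" by (rule single_reps[OF h])
  have "(x \<otimes>\<^bsub>UP R\<^esub> ?y) j \<in> IP (Suc j)" for j
  proof -
    have "x i \<otimes> ?y (j - i) \<in> IP (Suc j)" if "i \<le> j" for i
    proof (cases "j - i = n")
      case True
      then show ?thesis using xh[of i] that by (auto simp: add.commute)
    qed (use repsD(3)[OF x] IP_zero in auto)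
    then have "(\<Oplus>i\<in>{..j}. x i \<otimes> ?y (j - i)) \<in> IP (Suc j)" by (intro finsum_IP) auto
    then show ?thesis using repsD(2)[OF x] repsD(2)[OF y] by (simp add: UP_def)
  qed
  then show ?thesis
    unfolding homogeneous_def using cls_eq_zero_iff[OF cls_mult(2)[OF x y]] cls_mult(1)[OF x y] by simp
qed

end

end

section \<open>Orders in a numerical semigroup\<close>

text \<open>For the semigroup generated by \<open>A\<close>, these are the elements of order at least \<open>n\<close>, that is, the
  exponents of the monomials in the \<open>n\<close>-th power of the maximal ideal.\<close>

definition sums_of :: "nat set \<Rightarrow> nat \<Rightarrow> nat set" where
  "sums_of A n = {sum_list xs | xs. set xs \<subseteq> A \<and> n \<le> length xs}"

lemma sums_ofI: "set xs \<subseteq> A \<Longrightarrow> n \<le> length xs \<Longrightarrow> s = sum_list xs \<Longrightarrow> s \<in> sums_of A n"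
  by (auto simp: sums_of_def)

lemma sums_of_antimono: "i \<le> j \<Longrightarrow> sums_of A j \<subseteq> sums_of A i"
  by (force simp: sums_of_def)

lemma sums_of_add: "x \<in> sums_of A i \<Longrightarrow> y \<in> sums_of A j \<Longrightarrow> x + y \<in> sums_of A (i + j)"
proof -
  assume "x \<in> sums_of A i" "y \<in> sums_of A j"
  then obtain xs ys where "set xs \<subseteq> A" "i \<le> length xs" "x = sum_list xs"
    "set ys \<subseteq> A" "j \<le> length ys" "y = sum_list ys" by (auto simp: sums_of_def)
  then show ?thesis by (intro sums_ofI[of "xs @ ys"]) auto
qed

lemma sums_of_base: "a \<in> A \<Longrightarrow> a \<in> sums_of A 1"
  by (rule sums_ofI[of "[a]"]) auto

lemma sums_of_multiple: "a \<in> A \<Longrightarrow> n * a \<in> sums_of A n"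
  by (rule sums_ofI[of "replicate n a"]) (auto simp: sum_list_replicate)

lemma generated_semigroup_eq_sums_of: "generated_semigroup A = sums_of A 0"
proof (intro equalityI subsetI)
  fix s assume "s \<in> generated_semigroup A"
  then show "s \<in> sums_of A 0"
  proof induction
    case zero
    show ?case by (rule sums_ofI[of "[]"]) auto
  next
    case (add a s)
    then show ?case using sums_of_add[OF sums_of_base, of a A s 0] sums_of_antimono[of 0 1 A] by auto
  qed
next
  fix s assume "s \<in> sums_of A 0"
  then obtain xs where "set xs \<subseteq> A" "s = sum_list xs" by (auto simp: sums_of_def)
  then show "s \<in> generated_semigroup A"
    by (induction xs arbitrary: s) (auto intro: generated_semigroup.intros)
qed

lemma sums_of_pos: "s \<in> sums_of A 0 \<Longrightarrow> s \<noteq> 0 \<Longrightarrow> s \<in> sums_of A 1"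
proof -
  assume "s \<in> sums_of A 0" "s \<noteq> 0"
  then obtain xs where "set xs \<subseteq> A" "s = sum_list xs" by (auto simp: sums_of_def)
  moreover from this have "xs \<noteq> []" using \<open>s \<noteq> 0\<close> by auto
  ultimately show ?thesis by (intro sums_ofI[of xs]) (auto simp: Suc_le_eq)
qed

lemma sums_of_ge:
  assumes "s \<in> sums_of A n" "\<And>a. a \<in> A \<Longrightarrow> k \<le> a"
  shows "n * k \<le> s"
proof -
  obtain xs where xs: "set xs \<subseteq> A" "n \<le> length xs" "s = sum_list xs"
    using assms by (auto simp: sums_of_def)
  have "n * k \<le> length xs * k" using xs by simp
  also have "\<dots> \<le> sum_list xs" using xs(1) assms(2) by (induction xs) (auto intro!: add_mono)
  finally show ?thesis using xs by simp
qed

section \<open>The tangent cone of a semigroup ring\<close>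

locale semigroup_ring =
  fixes R :: "'k::field fps ring" (structure) and I :: "'k fps set" and A :: "nat set"
  assumes finite_A: "finite A" and A_pos: "0 \<notin> A" and A_nonempty: "A \<noteq> {}"
    and R_eq: "R = power_series_subring A" and I_eq: "I = monomial_ideal A"
begin

sublocale graded R I
proof -
  interpret cring R unfolding R_eq by (rule power_series_subring_cring[OF finite_A A_pos])
  have "(\<lambda>a. fps_X ^ a) ` A \<subseteq> carrier R"
    using generated_semigroup_base unfolding R_eq carrier_power_series_subring[OF finite_A A_pos]
    by (auto simp: fps_X_power_nth split: if_splits)
  then have "ideal I R" unfolding I_eq monomial_ideal_def R_eq[symmetric] by (rule genideal_ideal)
  then show "graded R I" by (simp add: graded_def graded_axioms_def is_cring)
qed

lemma R_sel [simp]: "monoid.mult R = (*)" "one R = 1" "zero R = 0" "add R = (+)"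
  by (simp_all add: R_eq)

lemma carrier_iff: "f \<in> carrier R \<longleftrightarrow> (\<forall>s. fps_nth f s \<noteq> 0 \<longrightarrow> s \<in> sums_of A 0)"
  unfolding R_eq carrier_power_series_subring[OF finite_A A_pos] generated_semigroup_eq_sums_of by simp

lemma I_iff: "f \<in> I \<longleftrightarrow> f \<in> carrier R \<and> fps_nth f 0 = 0"
  unfolding I_eq monomial_ideal_eq[OF finite_A A_pos] R_eq by simp

(* The simplifier would rewrite the power of exponent Suc n, and the facts below, which are stated for
   folded powers, would no longer apply. *)
context
  notes nat_pow_Suc [simp del] Group.nat_pow_Suc [simp del]
    and nat_pow_0 [simp del] Group.nat_pow_0 [simp del]
begin

lemma monomial_mem_IP:
  assumes "s \<in> sums_of A n" shows "fps_X ^ s \<in> IP n"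
proof -
  obtain xs where xs: "set xs \<subseteq> A" "n \<le> length xs" "s = sum_list xs"
    using assms by (auto simp: sums_of_def)
  have gen: "fps_X ^ a \<in> IP 1" if "a \<in> A" for a
  proof -
    have "fps_X ^ a \<in> carrier R" using sums_of_base[OF that] sums_of_antimono[of 0 1 A]
      unfolding carrier_iff by (auto simp: fps_X_power_nth split: if_splits)
    moreover have "a \<noteq> 0" using that A_pos by metis
    ultimately show ?thesis
      by (simp add: I_iff fps_X_power_nth)
  qed
  have "fps_X ^ sum_list xs \<in> IP (length xs)"
    using xs(1)
  proof (induction xs)
    case Nil
    then show ?case using one_closed by simp
  next
    case (Cons a xs)
    then show ?case using IP_mult[OF gen[of a], of "fps_X ^ sum_list xs" "length xs"]
      by (simp add: power_add)
  qed
  then show ?thesis using IP_antimono xs by blast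
qed

text \<open>Together with \<open>monomial_mem_IP\<close> this translates membership of \<open>t\<^sup>s\<close> in a power of the maximal ideal
  into the order of \<open>s\<close>.\<close>

lemma IP_support:
  assumes "f \<in> IP n" "fps_nth f s \<noteq> 0" shows "s \<in> sums_of A n"
  using assms
proof (induction n arbitrary: f s)
  case 0
  then show ?case using carrier_iff by simp
next
  case (Suc n)
  have "f \<in> ideal_prod R (IP n) I" using Suc.prems(1) by (simp add: IP_Suc)
  then show ?case using Suc.prems(2)
  proof (induction arbitrary: s)
    case (prod f g)
    then obtain i where i: "i \<le> s" "fps_nth f i * fps_nth g (s - i) \<noteq> 0"
      unfolding R_sel fps_mult_nth by (metis (no_types, lifting) atLeastAtMost_iff sum.neutral)
    then have "i \<in> sums_of A n" using Suc.IH prod by auto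
    moreover have "g \<in> carrier R" "fps_nth g 0 = 0"
      using prod(2) by (simp_all add: I_iff)
    then have "s - i \<in> sums_of A 0" "s - i \<noteq> 0" using i carrier_iff by (auto intro!: gr0I)
    then have "s - i \<in> sums_of A 1" by (rule sums_of_pos)
    ultimately show ?case using sums_of_add[of i A n "s - i" 1] i by simp
  next
    case (sum f g)
    then show ?case by (cases "fps_nth f s = 0") auto
  qed
qed

lemma IP_nth_Min: "f \<in> IP n \<Longrightarrow> j < n * Min A \<Longrightarrow> fps_nth f j = 0"
  using sums_of_ge[OF IP_support, of f n j "Min A"] finite_A by (metis Min_le not_less)

text \<open>The surjection of the associated graded ring onto \<open>K[T]\<close> with \<open>T\<close> the class of
  \<open>t\<^sup>\<mu>\<close>, where \<open>\<mu> = Min A\<close>, that kills the classes of the other generators. It reads off the coefficient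
  of \<open>t\<^sup>n\<^sup>\<mu>\<close> in degree \<open>n\<close>, which does not depend on the representative since series in the
  \<open>(n + 1)\<close>-st power have order at least \<open>(n + 1) \<mu>\<close>. The polynomial is written as a power series, so
  that its coefficients can be prescribed without first showing that almost all of them vanish.\<close>

definition Min_part :: "(nat \<Rightarrow> 'k fps set) \<Rightarrow> 'k fps" where
  "Min_part f = Abs_fps (\<lambda>n. fps_nth (SOME h. h \<in> f n) (n * Min A))"

lemma Min_part_cls:
  assumes "x \<in> reps"
  shows "Min_part (cls x) = Abs_fps (\<lambda>n. fps_nth (x n) (n * Min A))"
proof -
  have "fps_nth (SOME h. h \<in> cls x n) (n * Min A) = fps_nth (x n) (n * Min A)" for n
  proof -
    interpret J: ideal "IP (Suc n)" R by (rule IP_ideal)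
    have "x n \<in> cls x n" using J.a_rcos_self repsD(3)[OF assms] by (simp add: cls_def)
    then have "(SOME h. h \<in> cls x n) \<in> cls x n" by (rule someI)
    then obtain h where h: "h \<in> IP (Suc n)" "(SOME h. h \<in> cls x n) = h + x n"
      by (auto simp: cls_def a_r_coset_def')
    have "0 < Min A" using finite_A A_nonempty A_pos by (metis Min_in gr0I)
    then show ?thesis using IP_nth_Min[OF h(1), of "n * Min A"] h(2) by simp
  qed
  then show ?thesis by (simp add: Min_part_def)
qed

lemma Min_part_hom:
  shows Min_part_add: "f \<in> carrier (assoc_graded R I) \<Longrightarrow> g \<in> carrier (assoc_graded R I) \<Longrightarrow>
      Min_part (f \<oplus>\<^bsub>assoc_graded R I\<^esub> g) = Min_part f + Min_part g"
    and Min_part_mult: "f \<in> carrier (assoc_graded R I) \<Longrightarrow> g \<in> carrier (assoc_graded R I) \<Longrightarrow>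
      Min_part (f \<otimes>\<^bsub>assoc_graded R I\<^esub> g) = Min_part f * Min_part g"
    and Min_part_one: "Min_part \<one>\<^bsub>assoc_graded R I\<^esub> = 1"
proof -
  show "Min_part (f \<oplus>\<^bsub>assoc_graded R I\<^esub> g) = Min_part f + Min_part g"
      "Min_part (f \<otimes>\<^bsub>assoc_graded R I\<^esub> g) = Min_part f * Min_part g"
    if fg: "f \<in> carrier (assoc_graded R I)" "g \<in> carrier (assoc_graded R I)"
  proof -
    obtain x y where x: "x \<in> reps" "f = cls x" and y: "y \<in> reps" "g = cls y"
      using fg by (auto simp: carrier_assoc_graded)
    note up = repsD(2)[OF x(1)] repsD(2)[OF y(1)]
    have "(x \<oplus>\<^bsub>UP R\<^esub> y) n = x n + y n" for n using up by (simp add: UP_def)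
    then show "Min_part (f \<oplus>\<^bsub>assoc_graded R I\<^esub> g) = Min_part f + Min_part g"
      using x y by (simp add: cls_add Min_part_cls fps_eq_iff)
    have "fps_nth ((x \<otimes>\<^bsub>UP R\<^esub> y) n) (n * Min A)
        = (\<Sum>i=0..n. fps_nth (x i) (i * Min A) * fps_nth (y (n - i)) ((n - i) * Min A))" for n
    proof -
      have sumR: "finsum R F B = sum F B" if "finite B" "F \<in> B \<rightarrow> carrier R" for F and B :: "nat set"
        using that by (induction B) auto
      \<comment> \<open>A factor in the \<open>i\<close>-th power starts at exponent \<open>i * Min A\<close> or later, so only the product of
        the two lowest possible terms contributes.\<close>
      have xy: "fps_nth (x i * y (n - i)) (n * Min A)
          = fps_nth (x i) (i * Min A) * fps_nth (y (n - i)) ((n - i) * Min A)" if i: "i \<le> n" for i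
      proof -
        have n: "n * Min A = i * Min A + (n - i) * Min A"
          using i by (simp flip: add_mult_distrib)
        have "fps_nth (x i) k * fps_nth (y (n - i)) (n * Min A - k) = 0"
          if "k \<noteq> i * Min A" "k \<le> n * Min A" for k
        proof (cases "k < i * Min A")
          case True
          then show ?thesis using IP_nth_Min[OF repsD(1)[OF x(1)]] by simp
        next
          case False
          then have "n * Min A - k < (n - i) * Min A" using that n by linarith
          then show ?thesis using IP_nth_Min[OF repsD(1)[OF y(1)]] by simp
        qed
        then have "(\<Sum>k=0..n * Min A. fps_nth (x i) k * fps_nth (y (n - i)) (n * Min A - k))
          = (\<Sum>k\<in>{i * Min A}. fps_nth (x i) k * fps_nth (y (n - i)) (n * Min A - k))"
          using n by (intro sum.mono_neutral_right) auto
        then show ?thesis using n by (simp add: fps_mult_nth)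
      qed
      have "(x \<otimes>\<^bsub>UP R\<^esub> y) n = (\<Sum>i\<le>n. x i * y (n - i))"
        using up sumR[of "{..n}" "\<lambda>i. x i * y (n - i)"] m_closed repsD(3)[OF x(1)] repsD(3)[OF y(1)]
        by (simp add: UP_def)
      then show ?thesis using xy by (simp add: fps_sum_nth atMost_atLeast0)
    qed
    then show "Min_part (f \<otimes>\<^bsub>assoc_graded R I\<^esub> g) = Min_part f * Min_part g"
      using x y by (simp add: cls_mult Min_part_cls fps_eq_iff fps_mult_nth)
  qed
  show "Min_part \<one>\<^bsub>assoc_graded R I\<^esub> = 1"
    by (simp add: cls_one Min_part_cls fps_eq_iff) (simp add: UP_def)
qed

lemma Min_part_homogeneous:
  "h \<in> IP n \<Longrightarrow> Min_part (homogeneous n h) = fps_const (fps_nth h (n * Min A)) * fps_X ^ n"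
  unfolding homogeneous_def by (simp add: Min_part_cls single_reps fps_eq_iff fps_X_power_nth)

text \<open>Since \<open>t\<^sup>a t\<^sup>s\<close> lies in the power \<open>n + 2\<close> of the maximal ideal \<open>I\<close> for all generators \<open>a\<close>, so does
  all of \<open>I t\<^sup>s\<close>. Hence the class of \<open>t\<^sup>s\<close> in degree \<open>n\<close> is killed by every homogeneous element of
  positive degree; it is nonzero because the order of \<open>s\<close> is exactly \<open>n\<close>.\<close>

theorem not_cohen_macaulay_if_order_jumps:
  assumes s: "s \<in> sums_of A n" "s \<notin> sums_of A (Suc n)"
    and jump: "\<And>a. a \<in> A \<Longrightarrow> s + a \<in> sums_of A (n + 2)"
  shows "\<not> cohen_macaulay (assoc_graded R I)"
proof -
  let ?G = "assoc_graded R I"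
  interpret G: cring ?G by (rule assoc_graded_cring)
  define M where "M = {f \<in> carrier ?G. fps_nth (Min_part f) 0 = 0}"
  define P where "P = {f \<in> carrier ?G. Min_part f = 0}"
  have maximal: "maximalideal M ?G"
    unfolding M_def
  proof (rule G.maximalideal_kernel)
    fix c :: 'k
    have c: "fps_const c \<in> IP 0" using one_closed unfolding IP_0 carrier_iff by auto
    then have "fps_nth (Min_part (homogeneous 0 (fps_const c))) 0 = c"
      by (simp add: Min_part_homogeneous)
    then show "\<exists>f\<in>carrier ?G. fps_nth (Min_part f) 0 = c" using homogeneous_carrier[OF c] by blast
  qed (simp_all add: Min_part_hom)
  have prime: "primeideal P ?G"
    unfolding P_def by (rule G.primeideal_kernel) (simp_all add: Min_part_hom)
  have X: "fps_X ^ Min A \<in> IP 1"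
    using monomial_mem_IP[OF sums_of_base[of "Min A" A]] finite_A A_nonempty by simp
  have "homogeneous 1 (fps_X ^ Min A) \<in> M - P"
    using Min_part_homogeneous[OF X] homogeneous_carrier[OF X] by (simp add: M_def P_def)
  then have "P \<subset> M" unfolding P_def M_def by auto
  have t: "fps_X ^ s \<in> IP n" by (rule monomial_mem_IP[OF s(1)])
  have t': "fps_X ^ s \<notin> IP (Suc n)"
    using IP_support[of "fps_X ^ s" "Suc n" s] s(2) by auto
  \<comment> \<open>The multipliers of \<open>t\<^sup>s\<close> into the power \<open>n + 2\<close> of \<open>I\<close> form an ideal, which contains the generators of \<open>I\<close>.\<close>
  have I_t: "f * fps_X ^ s \<in> IP (n + 2)" if "f \<in> I" for f
  proof -
    interpret J: ideal "IP (n + 2)" R by (rule IP_ideal)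
    have "ideal {f \<in> carrier R. f * fps_X ^ s \<in> IP (n + 2)} R"
    proof (rule idealI_closed)
      fix f g assume "f \<in> {f \<in> carrier R. f * fps_X ^ s \<in> IP (n + 2)}" "g \<in> {f \<in> carrier R. f * fps_X ^ s \<in> IP (n + 2)}"
      then show "f \<oplus> g \<in> {f \<in> carrier R. f * fps_X ^ s \<in> IP (n + 2)}"
        using J.a_closed[of "f * fps_X ^ s" "g * fps_X ^ s"] a_closed[of f g] by (simp add: distrib_right)
    next
      fix f g assume "f \<in> {f \<in> carrier R. f * fps_X ^ s \<in> IP (n + 2)}" "g \<in> carrier R"
      then show "g \<otimes> f \<in> {f \<in> carrier R. f * fps_X ^ s \<in> IP (n + 2)}"
        using J.I_l_closed[of "f * fps_X ^ s" g] m_closed[of g f] by (simp add: mult.assoc)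
    qed (use zero_closed J.zero_closed in auto)
    moreover have "(\<lambda>a. fps_X ^ a) ` A \<subseteq> {f \<in> carrier R. f * fps_X ^ s \<in> IP (n + 2)}"
      using monomial_mem_IP[OF jump] monomial_mem_IP[OF sums_of_base]
      by (auto simp: power_add mult.commute I_iff)
    ultimately have "I \<subseteq> {f \<in> carrier R. f * fps_X ^ s \<in> IP (n + 2)}"
      unfolding I_eq monomial_ideal_def R_eq[symmetric] by (rule genideal_minimal)
    then show ?thesis using that by blast
  qed
  have kill: "f \<otimes>\<^bsub>?G\<^esub> homogeneous n (fps_X ^ s) = \<zero>\<^bsub>?G\<^esub>" if f: "f \<in> M" for f
  proof -
    obtain x where x: "x \<in> reps" "f = cls x" using f unfolding M_def carrier_assoc_graded by blast
    have "fps_nth (x 0) 0 = 0" using f x by (simp add: M_def Min_part_cls)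
    then have x0: "x 0 \<in> I" using repsD(3)[OF x(1), of 0] by (simp add: I_iff)
    have "x i * fps_X ^ s \<in> IP (Suc (i + n))" for i
    proof (cases i)
      case 0
      then show ?thesis using IP_mult[of "x 0" 1 "fps_X ^ s" n] x0 t by simp
    next
      case (Suc j)
      have "x i \<in> ideal_prod R (IP j) I" using repsD(1)[OF x(1), of i] Suc by (simp add: IP_Suc)
      then show ?thesis
      proof induction
        case (prod f g)
        have "f * (g * fps_X ^ s) \<in> IP (j + (n + 2))" using IP_mult[OF prod(1) I_t[OF prod(2)]] by simp
        then show ?case using Suc by (simp add: mult.assoc)
      next
        case (sum f g)
        then show ?case using additive_subgroup.a_closed[OF ideal.axioms(1)[OF IP_ideal]]
          by (fastforce simp: distrib_right)
      qed
    qed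
    then show ?thesis unfolding x(2) by (intro cls_mult_homogeneous_zero x t) simp
  qed
  show ?thesis
    by (rule G.not_cohen_macaulay_if_annihilated[OF maximal prime \<open>P \<subset> M\<close>
          homogeneous_carrier[OF t] homogeneous_nonzero[OF t t'] kill])
qed

end

end

section \<open>The semigroups of the family\<close>

lemma sum_list_two_values:
  fixes m d :: nat
  shows "set xs \<subseteq> {m, m + d} \<Longrightarrow> \<exists>b\<le>length xs. sum_list xs = length xs * m + b * d"
proof (induction xs)
  case (Cons x xs)
  then obtain b where b: "b \<le> length xs" "sum_list xs = length xs * m + b * d" by auto
  show ?case
  proof (cases "x = m")
    case True
    then show ?thesis using b by (intro exI[of _ b]) (auto simp: algebra_simps)
  next
    case False
    then have "x = m + d" using Cons.prems by auto
    then show ?thesis using b by (intro exI[of _ "Suc b"]) (auto simp: algebra_simps)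
  qed
qed simp

text \<open>Equality would imply \<open>b \<equiv> k\<close> modulo \<open>m\<close>, since \<open>d\<close> is a unit there, and hence \<open>b \<ge> k\<close> because of
  \<open>k < m\<close>. But then \<open>l \<ge> b \<ge> k > r\<close> makes the right-hand side too large.\<close>

lemma unbalanced_not_sum:
  fixes m d r k l b :: nat
  assumes "coprime m d" "r < k" "k < m" "b \<le> l"
  shows "r * m + k * d \<noteq> l * m + b * d"
proof
  assume eq: "r * m + k * d = l * m + b * d"
  show False
  proof (cases "b < k")
    case True
    have "int (k - b) * int d = (int l - int r) * int m"
      using True arg_cong[OF eq, of int] by (simp add: of_nat_diff algebra_simps)
    then have "int m dvd int (k - b) * int d" by simp
    then have "m dvd (k - b) * d" by (metis of_nat_dvd_iff of_nat_mult)
    then have "m dvd k - b" using assms(1) by (simp add: coprime_dvd_mult_left_iff)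
    then have "m \<le> k - b" using True by (intro dvd_imp_le) auto
    then show False using assms(3) by simp
  next
    case False
    then have "k * m \<le> l * m" "k * d \<le> b * d" using assms(4) by (intro mult_right_mono; simp)+
    then have "k * m \<le> r * m" using eq by linarith
    then show False using assms(2,3) by simp
  qed
qed

theorem corollary3p5:
  fixes e q d m :: nat and \<Gamma> :: "nat set"
  assumes "e \<ge> 4" and "q \<ge> 1" and "d \<ge> 1"
    and "m = e + 2 * q + 1" and "gcd m d = 1"
    and "\<Gamma> = generated_semigroup
           ({m, m + d} \<union> {(q + 1) * m + (q + i) * d | i. 2 \<le> i \<and> i \<le> e - 1})"
  shows "\<not> cohen_macaulay (tangent_cone \<Gamma> :: (nat \<Rightarrow> 'k::field fps set) ring)"
proof -
  define A where "A = {m, m + d} \<union> {(q + 1) * m + (q + i) * d | i. 2 \<le> i \<and> i \<le> e - 1}"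
  define g where "g i = (q + 1) * m + (q + i) * d" for i
  have A_eq: "A = {m, m + d} \<union> g ` {2..e - 1}" by (auto simp: A_def g_def)
  have g_A: "g i \<in> A" if "2 \<le> i" "i \<le> e - 1" for i using that by (auto simp: A_eq)
  have m_A: "m \<in> A" and md_A: "m + d \<in> A" by (auto simp: A_eq)
  have finite: "finite A" and pos: "0 \<notin> A" using assms(4) by (auto simp: A_eq g_def)
  \<comment> \<open>Every generator except \<open>m\<close> and \<open>m + d\<close> is at least \<open>g 2\<close>, so a sum with two or more terms could only
    use these two.\<close>
  have g2: "g 2 \<notin> sums_of A 2"
  proof
    assume "g 2 \<in> sums_of A 2"
    then obtain xs where xs: "set xs \<subseteq> A" "2 \<le> length xs" "g 2 = sum_list xs"
      by (auto simp: sums_of_def)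
    have "set xs \<subseteq> {m, m + d}"
    proof
      fix x assume x: "x \<in> set xs"
      show "x \<in> {m, m + d}"
      proof (rule ccontr)
        assume "x \<notin> {m, m + d}"
        moreover have "x \<in> A" using x xs(1) by blast
        ultimately obtain j where "2 \<le> j" "x = g j" by (auto simp: A_eq)
        then have "x \<ge> g 2" by (simp only: g_def) (intro add_left_mono mult_right_mono; simp)
        obtain ys zs where yz: "xs = ys @ x # zs" using x by (meson split_list)
        then have "ys @ zs \<noteq> []" using xs(2) by (cases ys) auto
        then obtain y where "y \<in> set (ys @ zs)" by (meson list.set_intros(1) neq_Nil_conv last_in_set)
        moreover have "y \<in> A" using \<open>y \<in> set (ys @ zs)\<close> yz xs(1) by auto
        ultimately have "y \<noteq> 0" "y \<le> sum_list (ys @ zs)"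
          using pos by (metis, blast intro: member_le_sum_list)
        moreover have "sum_list xs = x + sum_list (ys @ zs)" by (simp add: yz)
        ultimately show False using \<open>x \<ge> g 2\<close> xs(3) by linarith
      qed
    qed
    then obtain b where "b \<le> length xs" "(q + 1) * m + (q + 2) * d = length xs * m + b * d"
      using sum_list_two_values[of xs m d] xs(3) by (auto simp: g_def)
    then show False
      using unbalanced_not_sum[of m d "q + 1" "q + 2"] assms(1,4,5) by (auto simp: coprime_iff_gcd_eq_1)
  qed
  define s where "s k = g 2 + k * (m + d)" for k
  \<comment> \<open>\<open>Q k\<close>: the order of \<open>s k\<close> exceeds the value \<open>k + 1\<close> that its definition suggests.\<close>
  define Q where "Q k \<longleftrightarrow> s k \<in> sums_of A (k + 2)" for k
  have s_in: "s k \<in> sums_of A (k + 1)" for k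
    using sums_of_add[OF sums_of_base[OF g_A[of 2]] sums_of_multiple[OF md_A, of k]] assms(1)
    by (simp add: s_def)
  have "\<exists>k. Q k"
  proof (rule exI[of _ m])
    have "s m = g 2 + (m + d) * m" by (simp add: s_def algebra_simps)
    also have "\<dots> \<in> sums_of A (1 + (m + d))"
      using sums_of_add[OF sums_of_base[OF g_A[of 2]] sums_of_multiple[OF m_A, of "m + d"]] assms(1) by simp
    also have "\<dots> \<subseteq> sums_of A (m + 2)" using assms(3) by (intro sums_of_antimono) simp
    finally show "Q m" by (simp add: Q_def)
  qed
  moreover have "\<not> Q 0" using g2 by (simp add: Q_def s_def numeral_2_eq_2)
  ultimately obtain k where k: "\<not> Q k" "Q (Suc k)"
    using ex_least_nat_less[of Q] by blast
  have jump: "s k + a \<in> sums_of A (k + 3)" if a_A: "a \<in> A" for a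
  proof (cases "a = m + d")
    case True
    then show ?thesis using k(2) by (simp add: Q_def s_def add_ac numeral_3_eq_3)
  next
    case False
    have "g 2 + a \<in> sums_of A 3"
    proof (cases "a = m")
      case True
      then have "g 2 + a = (q + 2) * (m + d)" by (simp add: g_def algebra_simps)
      then show ?thesis using sums_of_multiple[OF md_A, of "q + 2"] sums_of_antimono[of 3 "q + 2" A] assms(2)
        by auto
    next
      case False
      then obtain j where j: "2 \<le> j" "j \<le> e - 1" "a = g j" using a_A \<open>a \<noteq> m + d\<close> by (auto simp: A_eq)
      show ?thesis
      proof (cases "j = e - 1")
        case True
        have "(q + 2) + (q + (e - 1)) = m" using assms(1,4) by simp
        then have "(q + 2) * d + (q + (e - 1)) * d = m * d" by (metis add_mult_distrib)
        then have "g 2 + a = (2 * q + 2 + d) * m"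
          by (simp add: j(3) True g_def algebra_simps)
        then show ?thesis using sums_of_multiple[OF m_A, of "2 * q + 2 + d"]
            sums_of_antimono[of 3 "2 * q + 2 + d" A] assms(2) by auto
      next
        case False
        have "g 2 + a = g (Suc j) + (q + 1) * (m + d)" by (simp add: j(3) g_def algebra_simps)
        then show ?thesis
          using sums_of_add[OF sums_of_base[OF g_A[of "Suc j"]] sums_of_multiple[OF md_A, of "q + 1"]]
            sums_of_antimono[of 3 "1 + (q + 1)" A] assms(2) j False by auto
      qed
    qed
    from sums_of_add[OF this sums_of_multiple[OF md_A, of k]] show ?thesis
      by (simp add: s_def add_ac)
  qed
  interpret semigroup_ring "power_series_subring A :: 'k fps ring" "monomial_ideal A" A
    using finite pos m_A by unfold_locales auto
  have "\<not> cohen_macaulay (assoc_graded (power_series_subring A :: 'k fps ring) (monomial_ideal A))"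
    using s_in[of k] k(1) jump
    by (intro not_cohen_macaulay_if_order_jumps[of "s k" "k + 1"]) (auto simp: Q_def numeral_3_eq_3)
  then show ?thesis
    using tangent_cone_generated[OF finite pos, where 'k = 'k] assms(6) by (simp add: A_def)
qed

end
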